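(* Let $m>0$ and let $\Gamma\subset\mathbb Z^2$ be a simply connected lattice region whose boundary is $\partial\Gamma=\alpha\cup\eta_+\cup\eta_-\cup\beta$, where $\alpha\subset\{x=0\}$ and $\beta\subset\{x=m\}$ are vertical intervals, and $\eta_+$ (upper boundary, joining the top endpoints of $\alpha$ and $\beta$) and $\eta_-$ (lower boundary, joining the bottom endpoints of $\alpha$ and $\beta$) are $x$-monotone lattice paths. Assume $O=(0,0)\in\alpha$. Let $\pi_\pm(i,j),\omega_\pm(i,j)\ge 0$ for $(i,j)\in\Gamma$ with $\pi_+(i,j)+\pi_-(i,j)+\omega_+(i,j)+\omega_-(i,j)=1$, and assume they are $y$-invariant: $\pi_\pm(i,j)=\pi_\pm(i,j')$ and $\omega_\pm(i,j)=\omega_\pm(i,j')$ for all $i,j,j'$. Let $\{X_t\}$ be the random walk started at $X_0=O$ with transition probabilities $\mathbf P[(i,j)\to(i\pm1,j)]=\pi_\pm(i,j)$ and $\mathbf P[(i,j)\to(i,j\pm1)]=\omega_\pm(i,j)$, which is absorbed (killed) whenever it tries to step outside $\Gamma$. Let $T$ be the first time $t$ with $X_t\in\beta$ and let $p(k)$ be the probability that $X_T=(m,k)$. Then $$p(k)^2\ \ge\ p(k+1)\,p(k-1)$$ for all $k\in\mathbb Z$ such that $(m,k+1)\in\beta$ and $(m,k-1)\in\beta$.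
   Context: A lattice path is a sequence of points of $\mathbb Z^2$ in which consecutive points are at distance $1$. An $x$-monotone lattice path is one along which the $x$-coordinate is weakly increasing. The region $\Gamma$ consists of the lattice points on and inside $\partial\Gamma$.
   Formalization: It is additionally assumed that β is the whole right side of Γ, i.e. Γ meets the line x=m only in β; if η₊ or η₋ may run along x=m beyond β, the walk can enter β from above or below along that line and the inequality can fail. *)

theory Defs
  imports "HOL-Probability.Probability"
begin

definition plane_pt :: "int \<times> int \<Rightarrow> real \<times> real" where
  "plane_pt p = (real_of_int (fst p), real_of_int (snd p))"

definition lattice_path :: "(int \<times> int) list \<Rightarrow> bool" where
  "lattice_path ps \<longleftrightarrow>
     ps \<noteq> [] \<and> successively (\<lambda>p q. dist (plane_pt p) (plane_pt q) = 1) ps"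

definition x_monotone_path :: "(int \<times> int) list \<Rightarrow> bool" where
  "x_monotone_path ps \<longleftrightarrow> lattice_path ps \<and> sorted (map fst ps)"

definition path_trace :: "(int \<times> int) list \<Rightarrow> (real \<times> real) set" where
  "path_trace ps = plane_pt ` set ps \<union>
     (\<Union>t\<in>{t. Suc t < length ps}. closed_segment (plane_pt (ps ! t)) (plane_pt (ps ! Suc t)))"

definition vertical_interval :: "int \<Rightarrow> int \<Rightarrow> int \<Rightarrow> (int \<times> int) set" where
  "vertical_interval i a b = {i} \<times> {a..b}"

text \<open>The boundary curve in the plane: the left side from \<open>(0, a0)\<close> to \<open>(0, a1)\<close>, the right
  side from \<open>(m, b0)\<close> to \<open>(m, b1)\<close>, and the two lattice paths.\<close>

definition boundary_curve ::
  "int \<Rightarrow> int \<Rightarrow> int \<Rightarrow> int \<Rightarrow> int \<Rightarrow> (int \<times> int) list \<Rightarrow> (int \<times> int) list \<Rightarrow> (real \<times> real) set" where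
  "boundary_curve m a0 a1 b0 b1 etap etam =
     closed_segment (plane_pt (0, a0)) (plane_pt (0, a1)) \<union> path_trace etap \<union>
     path_trace etam \<union> closed_segment (plane_pt (m, b0)) (plane_pt (m, b1))"

text \<open>The abscissa is non-integral so as to compare the horizontal steps of the two paths only: on
  a vertical line through lattice points, non-crossing paths may run along each other.\<close>

definition weakly_above :: "(int \<times> int) list \<Rightarrow> (int \<times> int) list \<Rightarrow> bool" where
  "weakly_above ps qs \<longleftrightarrow>
     (\<forall>x y y'. x \<notin> \<int> \<and> (x, y) \<in> path_trace ps \<and> (x, y') \<in> path_trace qs \<longrightarrow> y' \<le> y)"

definition enclosed_region :: "(real \<times> real) set \<Rightarrow> (int \<times> int) set" where
  "enclosed_region C = {p. plane_pt p \<in> C \<union> inside C}"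

definition step_prob ::
  "(int \<times> int \<Rightarrow> real) \<Rightarrow> (int \<times> int \<Rightarrow> real) \<Rightarrow> (int \<times> int \<Rightarrow> real) \<Rightarrow> (int \<times> int \<Rightarrow> real) \<Rightarrow>
   int \<times> int \<Rightarrow> int \<times> int \<Rightarrow> real" where
  "step_prob pip pim omp omm p q =
     (if q = (fst p + 1, snd p) then pip p
      else if q = (fst p - 1, snd p) then pim p
      else if q = (fst p, snd p + 1) then omp p
      else if q = (fst p, snd p - 1) then omm p
      else 0)"

definition neighbours :: "int \<times> int \<Rightarrow> (int \<times> int) set" where
  "neighbours p = {(fst p + 1, snd p), (fst p - 1, snd p), (fst p, snd p + 1), (fst p, snd p - 1)}"

text \<open>\<open>None\<close> is the state of the walk after it has been killed.\<close>

fun killed_kernel ::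
  "(int \<times> int) set \<Rightarrow> (int \<times> int \<Rightarrow> int \<times> int \<Rightarrow> real) \<Rightarrow>
   (int \<times> int) option \<Rightarrow> (int \<times> int) option \<Rightarrow> real" where
  "killed_kernel G K (Some p) (Some q) = (if q \<in> G then K p q else 0)"
| "killed_kernel G K (Some p) None = (\<Sum>q\<in>neighbours p - G. K p q)"
| "killed_kernel G K None None = 1"
| "killed_kernel G K None (Some q) = 0"

definition markov_chain ::
  "'w measure \<Rightarrow> (nat \<Rightarrow> 'w \<Rightarrow> 's) \<Rightarrow> 's \<Rightarrow> ('s \<Rightarrow> 's \<Rightarrow> real) \<Rightarrow> bool" where
  "markov_chain M X s0 K \<longleftrightarrow>
     prob_space M \<and>
     (\<forall>t. X t \<in> measurable M (count_space UNIV)) \<and>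
     (AE w in M. X 0 w = s0) \<and>
     (\<forall>n h s. \<P>(w in M. \<forall>t\<le>n. X t w = h t) > 0 \<longrightarrow>
        \<P>(w in M. X (Suc n) w = s \<bar> \<forall>t\<le>n. X t w = h t) = K (h n) s)"

text \<open>The probability that \<open>X\<close> ever visits \<open>B\<close> and that its first visit to \<open>B\<close> is at \<open>q\<close>.\<close>

definition exit_prob ::
  "'w measure \<Rightarrow> (nat \<Rightarrow> 'w \<Rightarrow> (int \<times> int) option) \<Rightarrow> (int \<times> int) set \<Rightarrow> int \<times> int \<Rightarrow> real" where
  "exit_prob M X B q =
     \<P>(w in M. (\<exists>t. X t w \<in> Some ` B) \<and> X (LEAST t. X t w \<in> Some ` B) w = Some q)"

end

theory Submission
  imports Defs
begin

text \<open>Every column of the region is an interval. Let \<open>h\<^bsub>a\<^esub>(p)\<close> be the probability that the walk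
  from \<open>p\<close>, discounted by a factor \<open>z < 1\<close> per step, exits at \<open>a\<close>. The walks to \<open>(m, k - 1)\<close> are
  shifted up by one, which preserves their weights, so that they start above and end below the
  walks to \<open>(m, k + 1)\<close>. If the inequality failed, some \<open>c \<ge> 0\<close> would make
  \<open>c h\<^bsub>(m, k)\<^esub> - h\<^bsub>(m, k + 1)\<^esub>\<close> positive at the start \<open>(0, 1)\<close> in the shifted region and negative at
  the start \<open>(0, 0)\<close> in the original one. Let \<open>f\<close> be the same combination for the walk killed
  outside the intersection of the two regions. By the maximum principle \<open>f\<close> is positive at
  \<open>(0, 1)\<close> or next to the top rim of the shifted region, negative at \<open>(0, 0)\<close> or next to the
  bottom rim of the original one, and from these points \<open>{f > 0}\<close> reaches \<open>(m, k)\<close> and \<open>{f < 0}\<close>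
  reaches \<open>(m, k + 1)\<close>. Such walks cross, a contradiction. Finally \<open>z\<close> tends to 1.\<close>

section \<open>Crossing lattice walks\<close>

lemma mem_neighbours_iff: "q \<in> neighbours p \<longleftrightarrow> \<bar>fst q - fst p\<bar> + \<bar>snd q - snd p\<bar> = 1"
  by (cases p; cases q) (auto simp: neighbours_def abs_if split: if_splits)

lemma neighbours_sym: "q \<in> neighbours p \<longleftrightarrow> p \<in> neighbours q"
  by (simp add: mem_neighbours_iff abs_minus_commute)

definition geometric_realization :: "(int \<times> int) set \<Rightarrow> (real \<times> real) set" where
  "geometric_realization S =
     (\<Union>p\<in>S. \<Union>q\<in>S \<inter> insert p (neighbours p). closed_segment (plane_pt p) (plane_pt q))"

lemma geometric_realization_mono: "S \<subseteq> T \<Longrightarrow> geometric_realization S \<subseteq> geometric_realization T"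
  unfolding geometric_realization_def by blast

lemma closed_segment_subset_geometric_realization:
  assumes "p \<in> S" "q \<in> S" "q \<in> insert p (neighbours p)"
  shows "closed_segment (plane_pt p) (plane_pt q) \<subseteq> geometric_realization S"
  using assms unfolding geometric_realization_def by blast

lemma geometric_realization_subset_box:
  assumes "S \<subseteq> {x0..x1} \<times> {y0..y1}"
  shows "geometric_realization S \<subseteq>
    {real_of_int x0..real_of_int x1} \<times> {real_of_int y0..real_of_int y1}"
proof -
  have "plane_pt ` S \<subseteq> {real_of_int x0..real_of_int x1} \<times> {real_of_int y0..real_of_int y1}"
    using assms by (auto simp: plane_pt_def)
  then show ?thesis
    unfolding geometric_realization_def
    by (intro UN_least closed_segment_subset convex_Times convex_real_interval) auto
qed

lemma round_segment_of_unit_step: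
  assumes "\<bar>j - i\<bar> \<le> 1" "x \<in> closed_segment (real_of_int i) (real_of_int j)"
  shows "round x \<in> {i, j}"
proof -
  have "min i j \<le> x" "x \<le> max i j"
    using assms(2) by (auto simp: closed_segment_eq_real_ivl split: if_splits)
  then have "min i j \<le> round x" "round x \<le> max i j"
    using round_mono[of "min i j" x] round_mono[of x "max i j"] by simp_all
  then show ?thesis using assms(1) by auto
qed

text \<open>Rounding retracts an edge onto its two endpoints, so the realizations of disjoint sets are
  disjoint.\<close>

lemma round_geometric_realization:
  assumes "z \<in> geometric_realization S"
  shows "(round (fst z), round (snd z)) \<in> S"
proof -
  obtain p q where S: "p \<in> S" "q \<in> S" and edge: "q \<in> insert p (neighbours p)"
    and z: "z \<in> closed_segment (plane_pt p) (plane_pt q)"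
    using assms by (auto simp: geometric_realization_def)
  have coords: "fst z \<in> closed_segment (real_of_int (fst p)) (real_of_int (fst q))"
    "snd z \<in> closed_segment (real_of_int (snd p)) (real_of_int (snd q))"
    using z closed_segment_PairD[of "fst z" "snd z"] by (auto simp: plane_pt_def)
  have "\<bar>fst q - fst p\<bar> + \<bar>snd q - snd p\<bar> \<le> 1"
    using edge by (auto simp: mem_neighbours_iff)
  then have "fst q = fst p \<and> \<bar>snd q - snd p\<bar> \<le> 1 \<or> snd q = snd p \<and> \<bar>fst q - fst p\<bar> \<le> 1" by auto
  then have "(round (fst z), round (snd z)) \<in> {p, q}"
    using round_segment_of_unit_step[OF _ coords(1)] round_segment_of_unit_step[OF _ coords(2)]
    by (auto simp: prod_eq_iff)
  then show ?thesis using S by auto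
qed

definition linked :: "(int \<times> int) set \<Rightarrow> int \<times> int \<Rightarrow> int \<times> int \<Rightarrow> bool" where
  "linked S p q \<longleftrightarrow> path_component (geometric_realization S) (plane_pt p) (plane_pt q)"

lemma linked_sym: "linked S p q \<Longrightarrow> linked S q p"
  unfolding linked_def by (rule path_component_sym)

lemma linked_trans: "linked S p q \<Longrightarrow> linked S q r \<Longrightarrow> linked S p r"
  unfolding linked_def by (rule path_component_trans)

lemma linked_mono: "linked S p q \<Longrightarrow> S \<subseteq> T \<Longrightarrow> linked T p q"
  unfolding linked_def by (rule path_component_of_subset[OF geometric_realization_mono])

lemma linked_edge: "p \<in> S \<Longrightarrow> q \<in> S \<Longrightarrow> q \<in> insert p (neighbours p) \<Longrightarrow> linked S p q"
  unfolding linked_def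
  by (intro path_component_linepath closed_segment_subset_geometric_realization)

lemma linked_refl: "p \<in> S \<Longrightarrow> linked S p p"
  by (rule linked_edge) auto

lemma linked_imp_mem:
  assumes "linked S p q"
  shows "p \<in> S" "q \<in> S"
proof -
  have "plane_pt p \<in> geometric_realization S" "plane_pt q \<in> geometric_realization S"
    using assms path_component_mem unfolding linked_def by blast+
  then show "p \<in> S" "q \<in> S"
    using round_geometric_realization by (fastforce simp: plane_pt_def)+
qed

lemma linked_chain:
  fixes f :: "int \<Rightarrow> int \<times> int"
  assumes "a \<le> b" "f ` {a..b} \<subseteq> S" "\<And>k. f (k + 1) \<in> neighbours (f k)"
  shows "linked S (f a) (f b)"
  using assms(1,2)
proof (induction b rule: int_ge_induct)
  case base
  then show ?case by (simp add: linked_refl)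
next
  case (step b)
  then have "linked S (f a) (f b)" by force
  moreover have "linked S (f b) (f (b + 1))"
    using step assms(3) by (intro linked_edge) auto
  ultimately show ?case by (rule linked_trans)
qed

lemma linked_vertical: "j \<le> j' \<Longrightarrow> {i} \<times> {j..j'} \<subseteq> S \<Longrightarrow> linked S (i, j) (i, j')"
  by (rule linked_chain[of j j' "Pair i"]) (auto simp: mem_neighbours_iff)

lemma linked_horizontal: "i \<le> i' \<Longrightarrow> {i..i'} \<times> {j} \<subseteq> S \<Longrightarrow> linked S (i, j) (i', j)"
  by (rule linked_chain[of i i' "\<lambda>x. (x, j)"]) (auto simp: mem_neighbours_iff)

lemma crossing_path_components_meet:
  fixes x0 x1 y0 y1 c d e f :: real
  assumes S: "path_component S (x0, c) (x1, d)" "S \<subseteq> {x0..x1} \<times> {y0..y1}"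
    and T: "path_component T (e, y0) (f, y1)" "T \<subseteq> {x0..x1} \<times> {y0..y1}"
  shows "S \<inter> T \<noteq> {}"
proof -
  define vec :: "real \<times> real \<Rightarrow> real ^ 2" where "vec p = vector [fst p, snd p]" for p
  have vec_nth: "vec p $ 1 = fst p" "vec p $ 2 = snd p" for p by (simp_all add: vec_def)
  have "continuous_on UNIV (\<lambda>p :: real \<times> real. (\<chi> i. if i = 1 then fst p else snd p) :: real ^ 2)"
  proof (rule continuous_on_vec_lambda)
    show "continuous_on UNIV (\<lambda>p :: real \<times> real. if i = 1 then fst p else snd p)" for i :: 2
      by (cases "i = 1") (simp_all add: continuous_on_fst continuous_on_snd)
  qed
  moreover have "vec = (\<lambda>p. (\<chi> i. if i = 1 then fst p else snd p))"
    by (simp add: fun_eq_iff vec_eq_iff vec_nth forall_2)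
  ultimately have cont: "continuous_on A vec" for A using continuous_on_subset by blast
  have "inj vec" by (auto simp: inj_def vec_eq_iff vec_nth forall_2 prod_eq_iff)
  obtain g h where g: "path g" "path_image g \<subseteq> S" "pathstart g = (x0, c)" "pathfinish g = (x1, d)"
    and h: "path h" "path_image h \<subseteq> T" "pathstart h = (e, y0)" "pathfinish h = (f, y1)"
    using S(1) T(1) unfolding path_component_def by blast
  have box: "vec ` A \<subseteq> cbox (vec (x0, y0)) (vec (x1, y1))" if "A \<subseteq> {x0..x1} \<times> {y0..y1}" for A
    using that by (auto simp: mem_box_cart forall_2 vec_nth)
  obtain z where "z \<in> path_image (vec \<circ> g)" "z \<in> path_image (vec \<circ> h)"
  proof (rule fashoda)
    show "path (vec \<circ> g)" "path (vec \<circ> h)"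
      using g(1) h(1) cont by (simp_all add: path_continuous_image)
    show "path_image (vec \<circ> g) \<subseteq> cbox (vec (x0, y0)) (vec (x1, y1))"
      "path_image (vec \<circ> h) \<subseteq> cbox (vec (x0, y0)) (vec (x1, y1))"
      unfolding path_image_compose using g(2) h(2) S(2) T(2) by (auto intro!: box)
  qed (use g h in \<open>simp_all add: pathstart_compose pathfinish_compose vec_nth\<close>)
  then have "path_image g \<inter> path_image h \<noteq> {}"
    using \<open>inj vec\<close> by (auto simp: path_image_compose inj_eq)
  then show ?thesis using g(2) h(2) by blast
qed

lemma crossing_walks_meet:
  assumes "linked S (x0, c) (x1, d)" "S \<subseteq> {x0..x1} \<times> {y0..y1}"
    and "linked T (e, y0) (f, y1)" "T \<subseteq> {x0..x1} \<times> {y0..y1}"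
  shows "S \<inter> T \<noteq> {}"
proof -
  have "geometric_realization S \<inter> geometric_realization T \<noteq> {}"
    using assms geometric_realization_subset_box[OF assms(2)]
      geometric_realization_subset_box[OF assms(4)]
    unfolding linked_def plane_pt_def fst_conv snd_conv
    by (intro crossing_path_components_meet)
  then show ?thesis using round_geometric_realization by blast
qed

definition column_region :: "int \<Rightarrow> int \<Rightarrow> (int \<Rightarrow> int) \<Rightarrow> (int \<Rightarrow> int) \<Rightarrow> (int \<times> int) set" where
  "column_region a b l u = (SIGMA i:{a..b}. {l i..u i})"

lemma mem_column_region:
  "p \<in> column_region a b l u \<longleftrightarrow> fst p \<in> {a..b} \<and> l (fst p) \<le> snd p \<and> snd p \<le> u (fst p)"
  by (cases p) (simp add: column_region_def)

lemma finite_column_region: "finite (column_region a b l u)"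
  by (simp add: column_region_def)

lemma translate_up_column_region:
  "(\<lambda>p. p + (0, 1)) ` column_region a b l u = column_region a b (\<lambda>i. l i + 1) (\<lambda>i. u i + 1)"
proof (intro set_eqI iffI)
  fix p assume "p \<in> column_region a b (\<lambda>i. l i + 1) (\<lambda>i. u i + 1)"
  then have "p - (0, 1) \<in> column_region a b l u" by (auto simp: mem_column_region)
  then show "p \<in> (\<lambda>p. p + (0, 1)) ` column_region a b l u" by force
qed (auto simp: mem_column_region)

lemma linked_extend_bottom_top:
  assumes "linked S s (b, k)" "p \<in> neighbours s" "snd p \<le> y1" "y0 \<le> k"
  shows "linked (S \<union> {fst p} \<times> {snd p..y1} \<union> {b + 1} \<times> {y0..k}) (b + 1, y0) (fst p, y1)"
    (is "linked ?E _ _")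
proof -
  note ends = linked_imp_mem[OF assms(1)]
  have "linked ?E (b + 1, y0) (b + 1, k)"
    using assms(4) by (intro linked_vertical) auto
  moreover have "linked ?E (b + 1, k) (b, k)"
    using ends assms(4) by (intro linked_edge) (auto simp: mem_neighbours_iff)
  moreover have "linked ?E (b, k) s"
    using linked_sym[OF assms(1)] by (rule linked_mono) auto
  moreover have "linked ?E s p"
    using ends assms(2,3) by (intro linked_edge) (auto simp: mem_Times_iff)
  moreover have "linked ?E p (fst p, y1)"
    using assms(3) linked_vertical[of "snd p" y1 "fst p" ?E] by auto
  ultimately show ?thesis by (blast intro: linked_trans)
qed

lemma linked_extend_left_right:
  assumes "linked T t (b, k)" "q \<in> neighbours t" "y0 \<le> snd q" "a \<le> fst q"
  shows "linked (T \<union> {fst q} \<times> {y0..snd q} \<union> {a..fst q} \<times> {y0} \<union> {(b + 1, k)}) (a, y0) (b + 1, k)"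
    (is "linked ?F _ _")
proof -
  note ends = linked_imp_mem[OF assms(1)]
  have "linked ?F (a, y0) (fst q, y0)"
    using assms(4) by (intro linked_horizontal) auto
  moreover have "linked ?F (fst q, y0) q"
    using assms(3) linked_vertical[of y0 "snd q" "fst q" ?F] by auto
  moreover have "linked ?F q t"
    using ends assms(2,3) neighbours_sym[of q t] by (intro linked_edge) (auto simp: mem_Times_iff)
  moreover have "linked ?F t (b, k)"
    using assms(1) by (rule linked_mono) auto
  moreover have "linked ?F (b, k) (b + 1, k)"
    using ends by (intro linked_edge) (auto simp: mem_neighbours_iff)
  ultimately show ?thesis by (blast intro: linked_trans)
qed

lemma rim_walks_meet:
  assumes sub: "S \<subseteq> column_region a b l u" "T \<subseteq> column_region a b l u"
    and gap: "\<And>i. i \<in> {a..b} \<Longrightarrow> l i \<le> u i + 1"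
    and upper: "linked S s (b, k)" "p \<in> neighbours s" "fst p \<in> {a..b}" "u (fst p) < snd p"
    and lower: "linked T t (b, k')" "q \<in> neighbours t" "fst q \<in> {a..b}" "snd q < l (fst q)"
    and "k < k'"
  shows "S \<inter> T \<noteq> {}"
proof
  assume disjoint: "S \<inter> T = {}"
  define D where "D = Max ((\<lambda>r. \<bar>snd r\<bar>) ` ({p, q} \<union> column_region a b l u)) + 1"
  have D: "-D < snd r \<and> snd r < D" if "r \<in> {p, q} \<union> column_region a b l u" for r
  proof -
    have "\<bar>snd r\<bar> \<le> Max ((\<lambda>r. \<bar>snd r\<bar>) ` ({p, q} \<union> column_region a b l u))"
      by (intro Max_ge imageI that) (simp add: finite_column_region)
    then show ?thesis unfolding D_def by linarith
  qed
  have pq: "-D < snd p" "snd p < D" "-D < snd q" "snd q < D" using D by auto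
  have ST: "fst r \<in> {a..b} \<and> l (fst r) \<le> snd r \<and> snd r \<le> u (fst r) \<and> -D < snd r \<and> snd r < D"
    if "r \<in> S \<union> T" for r
    using that sub D[of r] mem_column_region by blast
  have k: "-D < k" "k' < D"
    using ST[of "(b, k)"] ST[of "(b, k')"] linked_imp_mem upper(1) lower(1) by auto
  define E where "E = S \<union> {fst p} \<times> {snd p..D} \<union> {b + 1} \<times> {-D..k}"
  define F where "F = T \<union> {fst q} \<times> {-D..snd q} \<union> {a..fst q} \<times> {-D} \<union> {(b + 1, k')}"
  have "linked F (a, -D) (b + 1, k')"
    unfolding F_def using lower pq by (intro linked_extend_left_right) auto
  moreover have "linked E (b + 1, -D) (fst p, D)"
    unfolding E_def using upper pq k by (intro linked_extend_bottom_top) auto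
  moreover have "E \<subseteq> {a..b + 1} \<times> {-D..D}" "F \<subseteq> {a..b + 1} \<times> {-D..D}"
    using ST upper(3) lower(3) pq k \<open>k < k'\<close> by (force simp: E_def F_def)+
  ultimately have "F \<inter> E \<noteq> {}" by (intro crossing_walks_meet)
  moreover have False if "r \<in> E" "r \<in> F" for r
  proof -
    have "\<not> (r \<in> S \<and> r \<in> T)" using disjoint by blast
    then show False
      using that ST[of r] gap[of "fst r"] upper(3,4) lower(3,4) pq \<open>k < k'\<close>
      by (cases r) (auto simp: E_def F_def)
  qed
  ultimately show False by blast
qed

text \<open>The start of the walks lies in the column \<open>0\<close>; an additional empty column \<open>-1\<close>, with points
  above the height \<open>0\<close> and below the height \<open>1\<close>, turns it into a point of either rim.\<close>

lemma rim_or_start_walks_meet: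
  assumes sub: "S \<subseteq> column_region 0 m (\<lambda>i. l i + 1) u" "T \<subseteq> column_region 0 m (\<lambda>i. l i + 1) u"
    and lu: "\<And>i. i \<in> {0..m} \<Longrightarrow> l i \<le> u i" and "0 \<le> m"
    and upper: "linked S s (m, k)"
      "s = (0, 1) \<or> (\<exists>p\<in>neighbours s. fst p \<in> {0..m} \<and> u (fst p) < snd p)"
    and lower: "linked T t (m, k')"
      "t = (0, 0) \<or> (\<exists>q\<in>neighbours t. fst q \<in> {0..m} \<and> snd q \<le> l (fst q))"
    and "k < k'"
  shows "S \<inter> T \<noteq> {}"
proof -
  define l' u' where "l' = (\<lambda>i. l i + 1)(-1 := 1)" and "u' = u(-1 := 0)"
  obtain p where p: "p \<in> neighbours s" "fst p \<in> {-1..m}" "u' (fst p) < snd p"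
    using upper(2)
  proof
    assume "s = (0, 1)"
    then show ?thesis
      using that[of "(-1, 1)"] \<open>0 \<le> m\<close> by (auto simp: mem_neighbours_iff u'_def)
  qed (use that in \<open>auto simp: u'_def\<close>)
  obtain q where q: "q \<in> neighbours t" "fst q \<in> {-1..m}" "snd q < l' (fst q)"
    using lower(2)
  proof
    assume "t = (0, 0)"
    then show ?thesis
      using that[of "(-1, 0)"] \<open>0 \<le> m\<close> by (auto simp: mem_neighbours_iff l'_def)
  qed (use that in \<open>auto simp: l'_def\<close>)
  have "column_region 0 m (\<lambda>i. l i + 1) u \<subseteq> column_region (-1) m l' u'"
    by (auto simp: mem_column_region l'_def u'_def)
  then have "S \<subseteq> column_region (-1) m l' u'" "T \<subseteq> column_region (-1) m l' u'" using sub by auto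
  moreover have "l' i \<le> u' i + 1" if "i \<in> {-1..m}" for i
    using lu[of i] that by (auto simp: l'_def u'_def)
  ultimately show ?thesis
    using upper(1) p lower(1) q \<open>k < k'\<close>
    by (intro rim_walks_meet[where u = u' and p = p and k = k and l = l' and q = q and k' = k'])
      auto
qed

section \<open>The columns of the region\<close>

lemma mem_outside_vertical_ray:
  fixes C :: "(real \<times> real) set"
  assumes "bounded C" "{x} \<times> {y..} \<inter> C = {} \<or> {x} \<times> {..y} \<inter> C = {}"
  shows "(x, y) \<in> outside C"
proof -
  obtain r where r: "\<And>y. y \<in> snd ` C \<Longrightarrow> \<bar>y\<bar> \<le> r"
    using bounded_snd[OF assms(1)] by (auto simp: bounded_real)
  define b where "b = \<bar>y\<bar> + \<bar>r\<bar> + 1"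
  have "C \<subseteq> UNIV \<times> {-r..r}" using r by (force simp: abs_le_iff)
  then have far: "- (UNIV \<times> {-r..r}) \<subseteq> outside C"
    by (intro outside_subset_convex convex_Times convex_UNIV convex_real_interval)
  have ray: "(x, y) \<in> outside C"
    if "connected I" "y \<in> I" "y' \<in> I" "{x} \<times> I \<inter> C = {}" "\<bar>y'\<bar> = b" for I y'
  proof (rule outside_same_component)
    show "connected_component (- C) (x, y') (x, y)"
      using that(1-4) by (intro connected_componentI[of "{x} \<times> I"] connected_Times) auto
    have "(x, y') \<in> - (UNIV \<times> {-r..r})" using that(5) by (auto simp: b_def)
    then show "(x, y') \<in> outside C" using far by blast
  qed
  from assms(2) show ?thesis
  proof
    assume "{x} \<times> {y..} \<inter> C = {}"
    then show ?thesis by (intro ray[of "{y..}" b]) (simp_all add: b_def)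
  next
    assume "{x} \<times> {..y} \<inter> C = {}"
    then show ?thesis by (intro ray[of "{..y}" "- b"]) (simp_all add: b_def)
  qed
qed

lemma Un_inside_eq_vertically_convex:
  fixes C R :: "(real \<times> real) set"
  assumes "C \<subseteq> R" "compact R" "R - C \<subseteq> interior R"
    and convex: "\<And>x y y' y''. (x, y) \<in> R \<Longrightarrow> (x, y'') \<in> R \<Longrightarrow> y \<le> y' \<Longrightarrow> y' \<le> y'' \<Longrightarrow> (x, y') \<in> R"
  shows "C \<union> inside C = R"
proof
  have "frontier R \<subseteq> C"
    using assms(3) compact_imp_closed[OF assms(2)] by (auto simp: frontier_def)
  then have "inside (frontier R) - C \<subseteq> inside C" by (rule inside_mono)
  moreover have "interior R \<subseteq> inside (frontier R)"
    using assms(2) compact_imp_bounded interior_inside_frontier by blast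
  ultimately show "R \<subseteq> C \<union> inside C" using assms(3) by blast
next
  have "bounded C" using assms(1,2) compact_imp_bounded bounded_subset by blast
  have "(x, y) \<in> outside C" if "(x, y) \<notin> R" for x y
  proof -
    have "{x} \<times> {y..} \<inter> R = {} \<or> {x} \<times> {..y} \<inter> R = {}" using that convex by auto
    then show ?thesis using assms(1) by (intro mem_outside_vertical_ray[OF \<open>bounded C\<close>]) blast
  qed
  then show "C \<union> inside C \<subseteq> R" unfolding union_with_inside by auto
qed

text \<open>Over an integral abscissa \<open>i\<close> the fibre of a strip is bounded by \<open>lo i\<close> and \<open>hi i\<close>, and over
  the open interval between \<open>i\<close> and \<open>i + 1\<close> by \<open>f i\<close> and \<open>g i\<close>. The trace of a monotone path is a
  strip with \<open>f = g\<close>.\<close>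

definition strip ::
  "int \<Rightarrow> int \<Rightarrow> (int \<Rightarrow> int) \<Rightarrow> (int \<Rightarrow> int) \<Rightarrow> (int \<Rightarrow> int) \<Rightarrow> (int \<Rightarrow> int) \<Rightarrow> (real \<times> real) set" where
  "strip s m lo hi f g = {(x, y).
     if x \<in> \<int> then s \<le> x \<and> x \<le> m \<and> lo \<lfloor>x\<rfloor> \<le> y \<and> y \<le> hi \<lfloor>x\<rfloor>
     else s < x \<and> x < m \<and> f \<lfloor>x\<rfloor> \<le> y \<and> y \<le> g \<lfloor>x\<rfloor>}"

definition strip_bounds ::
  "int \<Rightarrow> int \<Rightarrow> (int \<Rightarrow> int) \<Rightarrow> (int \<Rightarrow> int) \<Rightarrow> (int \<Rightarrow> int) \<Rightarrow> (int \<Rightarrow> int) \<Rightarrow> bool" where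
  "strip_bounds s m lo hi f g \<longleftrightarrow> s \<le> m \<and> (\<forall>i\<in>{s..m}. lo i \<le> hi i) \<and>
     (\<forall>i\<in>{s..<m}. \<forall>j\<in>{i, i + 1}. lo j \<le> f i \<and> g i \<le> hi j)"

lemma mem_strip_column [simp]:
  fixes y :: real
  shows "(real_of_int i, y) \<in> strip s m lo hi f g \<longleftrightarrow> i \<in> {s..m} \<and> lo i \<le> y \<and> y \<le> hi i"
  by (auto simp: strip_def)

lemma not_Ints_between:
  assumes "real_of_int i < x" "x < of_int (i + 1)"
  shows "x \<notin> \<int>" "\<lfloor>x\<rfloor> = i"
proof -
  show "\<lfloor>x\<rfloor> = i" using assms by (simp add: floor_unique)
  then show "x \<notin> \<int>" using assms(1) by (auto elim!: Ints_cases)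
qed

lemma mem_strip_slab:
  assumes "real_of_int i < x" "x < of_int (i + 1)"
  shows "(x, y) \<in> strip s m lo hi f g \<longleftrightarrow> i \<in> {s..<m} \<and> f i \<le> y \<and> y \<le> g i"
proof -
  have "real_of_int s < x \<longleftrightarrow> s \<le> i" "x < real_of_int m \<longleftrightarrow> i < m"
    using assms by linarith+
  then show ?thesis using not_Ints_between[OF assms] by (auto simp: strip_def)
qed

lemma abscissa_cases:
  obtains (column) i where "x = real_of_int i"
  | (slab) i where "real_of_int i < x" "x < real_of_int (i + 1)"
proof (cases "x = of_int \<lfloor>x\<rfloor>")
  case True
  then show ?thesis by (rule column)
next
  case False
  then have "of_int \<lfloor>x\<rfloor> < x" by linarith
  then show ?thesis by (rule slab) linarith
qed

lemma strip_eq_Un: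
  assumes "strip_bounds s m lo hi f g"
  shows "strip s m lo hi f g =
    (\<Union>i\<in>{s..m}. {real_of_int i} \<times> {real_of_int (lo i)..real_of_int (hi i)}) \<union>
    (\<Union>i\<in>{s..<m}. {real_of_int i..real_of_int (i + 1)} \<times> {real_of_int (f i)..real_of_int (g i)})"
    (is "_ = ?columns \<union> ?slabs")
proof
  show "strip s m lo hi f g \<subseteq> ?columns \<union> ?slabs"
  proof clarify
    fix x y assume "(x, y) \<in> strip s m lo hi f g" "(x, y) \<notin> ?slabs"
    then show "(x, y) \<in> ?columns"
      by (cases x rule: abscissa_cases) (auto simp: mem_strip_slab)
  qed
next
  have "{real_of_int i..real_of_int (i + 1)} \<times> {real_of_int (f i)..real_of_int (g i)} \<subseteq>
    strip s m lo hi f g" if i: "i \<in> {s..<m}" for i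
  proof clarify
    fix x y assume x: "x \<in> {real_of_int i..real_of_int (i + 1)}"
      and y: "y \<in> {real_of_int (f i)..real_of_int (g i)}"
    have fibre: "real_of_int (lo j) \<le> y \<and> y \<le> real_of_int (hi j)" if "j = i \<or> j = i + 1" for j
    proof -
      have "lo j \<le> f i" "g i \<le> hi j" using assms i that by (auto simp: strip_bounds_def)
      then have "real_of_int (lo j) \<le> f i" "real_of_int (g i) \<le> hi j" by simp_all
      then show ?thesis using y by simp
    qed
    consider "x = of_int i" | "x = of_int (i + 1)" | "of_int i < x \<and> x < of_int (i + 1)"
      using x by force
    then show "(x, y) \<in> strip s m lo hi f g"
      using i y fibre mem_strip_column[of "i + 1"] by cases (auto simp: mem_strip_slab)
  qed
  then have "?slabs \<subseteq> strip s m lo hi f g" by (rule UN_least)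
  moreover have "?columns \<subseteq> strip s m lo hi f g" by auto
  ultimately show "?columns \<union> ?slabs \<subseteq> strip s m lo hi f g" by (rule Un_least[rotated])
qed

lemma compact_strip: "strip_bounds s m lo hi f g \<Longrightarrow> compact (strip s m lo hi f g)"
  unfolding strip_eq_Un by (intro compact_Un compact_UN compact_Times) auto

lemma closed_segment_plane_pt_vertical:
  "closed_segment (plane_pt (i, j)) (plane_pt (i, j')) =
     {real_of_int i} \<times> {real_of_int (min j j')..real_of_int (max j j')}"
proof -
  have "closed_segment (plane_pt (i, j)) (plane_pt (i, j')) =
      {real_of_int i} \<times> closed_segment (real_of_int j) (real_of_int j')"
    by (force simp: plane_pt_def closed_segment_def algebra_simps)
  then show ?thesis by (simp add: closed_segment_eq_real_ivl min_def max_def)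
qed

lemma closed_segment_plane_pt_horizontal:
  "closed_segment (plane_pt (i, j)) (plane_pt (i', j)) =
     {real_of_int (min i i')..real_of_int (max i i')} \<times> {real_of_int j}"
proof -
  have "closed_segment (plane_pt (i, j)) (plane_pt (i', j)) =
      closed_segment (real_of_int i) (real_of_int i') \<times> {real_of_int j}"
    by (force simp: plane_pt_def closed_segment_def algebra_simps)
  then show ?thesis by (simp add: closed_segment_eq_real_ivl min_def max_def)
qed

lemma dist_plane_pt_eq_1_iff: "dist (plane_pt p) (plane_pt q) = 1 \<longleftrightarrow> q \<in> neighbours p"
proof -
  define d e where "d = fst p - fst q" and "e = snd p - snd q"
  have "dist (plane_pt p) (plane_pt q) = sqrt (real_of_int (d\<^sup>2 + e\<^sup>2))"
    by (simp add: plane_pt_def dist_Pair_Pair dist_real_def d_def e_def)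
  then have "dist (plane_pt p) (plane_pt q) = 1 \<longleftrightarrow> d\<^sup>2 + e\<^sup>2 = 1"
    by (simp del: of_int_add of_int_power add: real_sqrt_eq_1_iff)
  also have "\<dots> \<longleftrightarrow> \<bar>d\<bar> + \<bar>e\<bar> = 1"
  proof
    assume sum: "d\<^sup>2 + e\<^sup>2 = 1"
    then have "d\<^sup>2 \<le> 1" "e\<^sup>2 \<le> 1" using zero_le_power2[of d] zero_le_power2[of e] by linarith+
    then have "\<bar>d\<bar> \<le> 1" "\<bar>e\<bar> \<le> 1" by (simp_all add: abs_square_le_1)
    then have "d = -1 \<or> d = 0 \<or> d = 1" "e = -1 \<or> e = 0 \<or> e = 1" by linarith+
    then show "\<bar>d\<bar> + \<bar>e\<bar> = 1" using sum by auto
  next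
    assume "\<bar>d\<bar> + \<bar>e\<bar> = 1"
    then have "e = 0 \<and> (d = 1 \<or> d = -1) \<or> d = 0 \<and> (e = 1 \<or> e = -1)" by linarith
    then show "d\<^sup>2 + e\<^sup>2 = 1" by auto
  qed
  finally show ?thesis by (simp add: mem_neighbours_iff d_def e_def abs_minus_commute)
qed

lemma path_trace_Cons_Cons:
  "path_trace (p # q # ps) = closed_segment (plane_pt p) (plane_pt q) \<union> path_trace (q # ps)"
proof -
  have "{t. Suc t < length (p # q # ps)} = insert 0 (Suc ` {t. Suc t < length (q # ps)})"
    by (auto simp: image_iff less_Suc_eq_0_disj)
  then show ?thesis by (auto simp: path_trace_def)
qed

lemma strip_Un_vertical_segment:
  assumes bounds: "strip_bounds s m lo hi h h" and j: "lo s \<le> j" "j \<le> hi s"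
  shows "closed_segment (plane_pt (s, j')) (plane_pt (s, j)) \<union> strip s m lo hi h h =
    strip s m (lo(s := min (lo s) j')) (hi(s := max (hi s) j')) h h"
    (is "?segment \<union> ?strip = ?strip'")
proof -
  have "s \<le> m" using bounds by (simp add: strip_bounds_def)
  have "(x, y) \<in> ?segment \<union> ?strip \<longleftrightarrow> (x, y) \<in> ?strip'" for x y
  proof (cases x rule: abscissa_cases)
    case (column i)
    have "real_of_int (lo s) \<le> j" "j \<le> real_of_int (hi s)" using j by simp_all
    then have "real_of_int (min j' j) \<le> y \<and> y \<le> max j' j \<or> lo s \<le> y \<and> y \<le> hi s \<longleftrightarrow>
        min (lo s) j' \<le> y \<and> y \<le> max (hi s) j'"
      unfolding of_int_min of_int_max min_le_iff_disj le_max_iff_disj by linarith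
    then show ?thesis
      using \<open>s \<le> m\<close> by (cases "i = s") (simp_all add: column closed_segment_plane_pt_vertical)
  next
    case (slab i)
    then have "x \<noteq> real_of_int s" using not_Ints_between(1)[OF slab] by auto
    then show ?thesis by (simp add: closed_segment_plane_pt_vertical mem_strip_slab[OF slab])
  qed
  then show ?thesis by (simp only: set_eq_iff split_paired_All simp_thms)
qed

lemma strip_Un_horizontal_segment:
  assumes bounds: "strip_bounds (s + 1) m lo hi h h" and j: "lo (s + 1) \<le> j" "j \<le> hi (s + 1)"
  shows "closed_segment (plane_pt (s, j)) (plane_pt (s + 1, j)) \<union> strip (s + 1) m lo hi h h =
    strip s m (lo(s := j)) (hi(s := j)) (h(s := j)) (h(s := j))"
    (is "?segment \<union> ?strip = ?strip'")
proof -
  have "s < m" using bounds by (simp add: strip_bounds_def)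
  have "(x, y) \<in> ?segment \<union> ?strip \<longleftrightarrow> (x, y) \<in> ?strip'" for x y
  proof (cases x rule: abscissa_cases)
    case (column i)
    have "real_of_int s \<le> real_of_int i \<and> real_of_int i \<le> real_of_int (s + 1) \<longleftrightarrow> i = s \<or> i = s + 1"
      unfolding of_int_le_iff by auto
    then show ?thesis
      using j \<open>s < m\<close> by (auto simp: closed_segment_plane_pt_horizontal column)
  next
    case (slab i)
    have "real_of_int s \<le> x \<and> x \<le> real_of_int (s + 1) \<longleftrightarrow> i = s"
      using slab by linarith
    then show ?thesis
      using \<open>s < m\<close> by (auto simp: closed_segment_plane_pt_horizontal mem_strip_slab[OF slab])
  qed
  then show ?thesis by (simp only: set_eq_iff split_paired_All simp_thms)
qed

definition strip_joins ::
  "int \<times> int \<Rightarrow> int \<times> int \<Rightarrow> (int \<Rightarrow> int) \<Rightarrow> (int \<Rightarrow> int) \<Rightarrow> (int \<Rightarrow> int) \<Rightarrow> bool" where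
  "strip_joins p q lo hi h \<longleftrightarrow> strip_bounds (fst p) (fst q) lo hi h h \<and>
     snd p \<in> {lo (fst p)..hi (fst p)} \<and> snd q \<in> {lo (fst q)..hi (fst q)}"

lemma strip_joinsD:
  assumes "strip_joins p q lo hi h"
  shows "i \<in> {fst p..fst q} \<Longrightarrow> lo i \<le> hi i"
    and "i \<in> {fst p..<fst q} \<Longrightarrow>
      lo i \<le> h i \<and> h i \<le> hi i \<and> lo (i + 1) \<le> h i \<and> h i \<le> hi (i + 1)"
    and "lo (fst p) \<le> snd p \<and> snd p \<le> hi (fst p)" "lo (fst q) \<le> snd q \<and> snd q \<le> hi (fst q)"
  using assms by (auto simp: strip_joins_def strip_bounds_def)

lemma strip_joins_prepend_edge:
  assumes joins: "strip_joins q r lo hi h" and "q \<in> neighbours p" "fst p \<le> fst q"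
  shows "\<exists>lo' hi' h'. strip_joins p r lo' hi' h' \<and>
    closed_segment (plane_pt p) (plane_pt q) \<union> strip (fst q) (fst r) lo hi h h =
    strip (fst p) (fst r) lo' hi' h' h'"
proof -
  obtain s j s' j' where p: "p = (s, j)" and q: "q = (s', j')" by (metis surj_pair)
  have bounds: "strip_bounds s' (fst r) lo hi h h" "lo s' \<le> j'" "j' \<le> hi s'"
    using joins by (simp_all add: strip_joins_def q)
  consider (vertical) "s' = s" | (horizontal) "s' = s + 1" "j' = j"
    using assms(2,3) by (auto simp: p q neighbours_def)
  then show ?thesis
  proof cases
    case vertical
    have "strip_joins p r (lo(s := min (lo s) j)) (hi(s := max (hi s) j)) h"
      using joins vertical
      by (auto simp: strip_joins_def strip_bounds_def p q min_le_iff_disj le_max_iff_disj)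
    then show ?thesis
      using strip_Un_vertical_segment[of s "fst r" lo hi h j' j] bounds vertical
      unfolding p q fst_conv by blast
  next
    case horizontal
    have "strip_joins p r (lo(s := j)) (hi(s := j)) (h(s := j))"
      using joins horizontal by (auto simp: strip_joins_def strip_bounds_def p q)
    then show ?thesis
      using strip_Un_horizontal_segment[of s "fst r" lo hi h j] bounds horizontal
      unfolding p q fst_conv by blast
  qed
qed

lemma path_trace_singleton:
  "path_trace [p] = strip (fst p) (fst p) (\<lambda>_. snd p) (\<lambda>_. snd p) h h"
proof -
  have "(x, y) \<in> path_trace [p] \<longleftrightarrow> (x, y) \<in> strip (fst p) (fst p) (\<lambda>_. snd p) (\<lambda>_. snd p) h h"
    for x y
    by (cases x rule: abscissa_cases) (auto simp: path_trace_def plane_pt_def mem_strip_slab)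
  then show ?thesis by (simp only: set_eq_iff split_paired_All simp_thms)
qed

lemma x_monotone_path_trace_eq_strip:
  assumes "x_monotone_path ps"
  shows "\<exists>lo hi h. strip_joins (hd ps) (last ps) lo hi h \<and>
    path_trace ps = strip (fst (hd ps)) (fst (last ps)) lo hi h h"
  using assms
proof (induction ps rule: induct_list012)
  case 1
  then show ?case by (simp add: x_monotone_path_def lattice_path_def)
next
  case (2 p)
  have "strip_joins p p (\<lambda>_. snd p) (\<lambda>_. snd p) h" for h
    by (simp add: strip_joins_def strip_bounds_def)
  then show ?case using path_trace_singleton by (intro exI[of _ "\<lambda>_. snd p"]) simp
next
  case (3 p q ps)
  then have edge: "q \<in> neighbours p" "fst p \<le> fst q" and "x_monotone_path (q # ps)"
    by (auto simp: x_monotone_path_def lattice_path_def dist_plane_pt_eq_1_iff)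
  then obtain lo hi h where "strip_joins q (last (q # ps)) lo hi h"
    and trace: "path_trace (q # ps) = strip (fst q) (fst (last (q # ps))) lo hi h h"
    using 3 by auto
  from strip_joins_prepend_edge[OF this(1) edge] show ?case
    unfolding path_trace_Cons_Cons trace by simp
qed

locale monotone_boundary =
  fixes m a0 a1 b0 b1 :: int and lo hi h lo' hi' h' :: "int \<Rightarrow> int"
  assumes width_pos: "0 < m"
    and upper: "strip_joins (0, a1) (m, b1) lo hi h"
    and lower: "strip_joins (0, a0) (m, b0) lo' hi' h'"
    and steps_ordered: "\<And>i. i \<in> {0..<m} \<Longrightarrow> h' i \<le> h i"
begin

definition curve :: "(real \<times> real) set" where
  "curve = closed_segment (plane_pt (0, a0)) (plane_pt (0, a1)) \<union> strip 0 m lo hi h h \<union>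
     strip 0 m lo' hi' h' h' \<union> closed_segment (plane_pt (m, b0)) (plane_pt (m, b1))"

definition filled :: "(real \<times> real) set" where
  "filled = strip 0 m (\<lambda>i. min (lo i) (lo' i)) (\<lambda>i. max (hi i) (hi' i)) h' h"

lemmas upper_bounds = strip_joinsD[OF upper, unfolded fst_conv snd_conv]

lemmas lower_bounds = strip_joinsD[OF lower, unfolded fst_conv snd_conv]

lemma filled_bounds: "strip_bounds 0 m (\<lambda>i. min (lo i) (lo' i)) (\<lambda>i. max (hi i) (hi' i)) h' h"
  using width_pos upper_bounds lower_bounds
  by (auto simp: strip_bounds_def min_le_iff_disj le_max_iff_disj)

lemma mem_curve_column:
  fixes y :: real
  shows "(real_of_int i, y) \<in> curve \<longleftrightarrow>
     i \<in> {0..m} \<and> (lo i \<le> y \<and> y \<le> hi i \<or> lo' i \<le> y \<and> y \<le> hi' i) \<or>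
     i = 0 \<and> min a0 a1 \<le> y \<and> y \<le> max a0 a1 \<or> i = m \<and> min b0 b1 \<le> y \<and> y \<le> max b0 b1"
  by (auto simp: curve_def closed_segment_plane_pt_vertical)

lemma mem_curve_slab:
  assumes "real_of_int i < x" "x < of_int (i + 1)"
  shows "(x, y) \<in> curve \<longleftrightarrow> i \<in> {0..<m} \<and> (y = h i \<or> y = h' i)"
proof -
  have "x \<noteq> real_of_int 0" "x \<noteq> real_of_int m" using not_Ints_between(1)[OF assms] by auto
  then show ?thesis
    by (auto simp: curve_def closed_segment_plane_pt_vertical mem_strip_slab[OF assms])
qed

lemma mem_filled_column:
  fixes y :: real
  shows "(real_of_int i, y) \<in> filled \<longleftrightarrow>
     i \<in> {0..m} \<and> real_of_int (min (lo i) (lo' i)) \<le> y \<and> y \<le> max (hi i) (hi' i)"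
  by (auto simp: filled_def)

lemma curve_subset_filled: "curve \<subseteq> filled"
proof (intro subsetI, clarify)
  fix x y assume "(x, y) \<in> curve"
  then show "(x, y) \<in> filled"
  proof (cases x rule: abscissa_cases)
    case (column i)
    have "min (lo 0) (lo' 0) \<le> min a0 a1" "max a0 a1 \<le> max (hi 0) (hi' 0)"
      "min (lo m) (lo' m) \<le> min b0 b1" "max b0 b1 \<le> max (hi m) (hi' m)"
      using upper_bounds(3,4) lower_bounds(3,4) by linarith+
    note sides = this[THEN iffD2[OF of_int_le_iff[where 'a = real]]]
    consider "i \<in> {0..m}" "lo i \<le> y \<and> y \<le> hi i \<or> lo' i \<le> y \<and> y \<le> hi' i"
      | "i = 0" "min a0 a1 \<le> y" "y \<le> max a0 a1" | "i = m" "min b0 b1 \<le> y" "y \<le> max b0 b1"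
      using \<open>(x, y) \<in> curve\<close>[unfolded column, unfolded mem_curve_column] by blast
    then show ?thesis
      using width_pos unfolding column unfolding mem_filled_column
      by cases (auto intro: order_trans[OF sides(1)] order_trans[OF _ sides(2)]
          order_trans[OF sides(3)] order_trans[OF _ sides(4)])
  next
    case (slab i)
    then show ?thesis
      using \<open>(x, y) \<in> curve\<close> steps_ordered
      by (auto simp: mem_curve_slab filled_def mem_strip_slab)
  qed
qed

lemma paths_overlap:
  assumes "i \<in> {0..m}"
  shows "lo' i \<le> hi i"
proof (cases "i < m")
  case True
  then show ?thesis
    using assms upper_bounds(2)[of i] lower_bounds(2)[of i] steps_ordered[of i] by auto
next
  case False
  then show ?thesis
    using assms width_pos upper_bounds(2)[of "i - 1"] lower_bounds(2)[of "i - 1"]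
      steps_ordered[of "i - 1"] by auto
qed

lemma filled_minus_curve_column:
  fixes y :: real
  assumes "(real_of_int i, y) \<in> filled" "(real_of_int i, y) \<notin> curve"
  shows "0 < i" "i < m" "real_of_int (hi' i) < y" "y < lo i"
proof -
  have i: "i \<in> {0..m}" and y: "min (lo i) (lo' i) \<le> y" "y \<le> max (hi i) (hi' i)"
    using assms(1) by (simp_all add: mem_filled_column)
  have "\<not> (lo i \<le> y \<and> y \<le> hi i)" "\<not> (lo' i \<le> y \<and> y \<le> hi' i)"
    using assms(2) i by (auto simp: mem_curve_column)
  moreover have "real_of_int (lo' i) \<le> hi i" using paths_overlap[OF i] by simp
  ultimately show between: "real_of_int (hi' i) < y" "y < lo i"
    using y unfolding of_int_min of_int_max by linarith+
  have "real_of_int a0 \<le> hi' 0" "real_of_int (lo 0) \<le> a1"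
    "real_of_int b0 \<le> hi' m" "real_of_int (lo m) \<le> b1"
    using upper_bounds(3,4) lower_bounds(3,4) by simp_all
  then have "i \<noteq> 0 \<and> i \<noteq> m" using assms(2)[unfolded mem_curve_column] between by auto
  then show "0 < i" "i < m" using i by auto
qed

lemma filled_minus_curve_slab:
  assumes "real_of_int i < x" "x < of_int (i + 1)" "(x, y) \<in> filled" "(x, y) \<notin> curve"
  shows "i \<in> {0..<m}" "real_of_int (h' i) < y" "y < h i"
  using assms(3,4) mem_curve_slab[OF assms(1,2)] mem_strip_slab[OF assms(1,2)]
  by (auto simp: filled_def less_le)

lemma gap_rectangle_subset_filled:
  assumes "0 < i" "i < m"
  shows "{real_of_int i - 1<..<of_int i + 1} \<times> {real_of_int (hi' i)<..<of_int (lo i)} \<subseteq> filled"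
proof clarify
  fix x y assume x: "x \<in> {real_of_int i - 1<..<real_of_int i + 1}"
    and y: "y \<in> {real_of_int (hi' i)<..<real_of_int (lo i)}"
  show "(x, y) \<in> filled"
  proof (cases x rule: abscissa_cases)
    case (column j)
    then have "j = i" using x by auto
    have "real_of_int (lo' i) \<le> hi' i" "real_of_int (lo i) \<le> hi i"
      using assms upper_bounds(1)[of i] lower_bounds(1)[of i] by auto
    then show ?thesis using assms y unfolding column \<open>j = i\<close> unfolding mem_filled_column by auto
  next
    case (slab j)
    then have j: "j = i \<or> j = i - 1" using x by force
    then have "h' j \<le> hi' i" "lo i \<le> h j"
      using assms upper_bounds(2)[of j] lower_bounds(2)[of j] by auto
    then have "real_of_int (h' j) \<le> hi' i" "real_of_int (lo i) \<le> h j" by simp_all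
    then show ?thesis using assms y j by (auto simp: filled_def mem_strip_slab[OF slab])
  qed
qed

lemma filled_minus_curve_subset_interior: "filled - curve \<subseteq> interior filled"
proof clarify
  fix x y assume off: "(x, y) \<in> filled" "(x, y) \<notin> curve"
  show "(x, y) \<in> interior filled"
  proof (cases x rule: abscissa_cases)
    case (column i)
    note gap = filled_minus_curve_column[OF off[unfolded column]]
    show ?thesis
    proof (rule interiorI[OF _ _ gap_rectangle_subset_filled[OF gap(1,2)]])
      show "(x, y) \<in> {real_of_int i - 1<..<of_int i + 1} \<times> {real_of_int (hi' i)<..<of_int (lo i)}"
        using gap by (simp add: column)
    qed (intro open_Times open_greaterThanLessThan)
  next
    case (slab i)
    note gap = filled_minus_curve_slab[OF slab off]
    show ?thesis
    proof (rule interiorI)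
      show "open ({real_of_int i<..<of_int (i + 1)} \<times> {real_of_int (h' i)<..<of_int (h i)})"
        by (intro open_Times open_greaterThanLessThan)
      show "{real_of_int i<..<of_int (i + 1)} \<times> {real_of_int (h' i)<..<of_int (h i)} \<subseteq> filled"
        using gap(1) by (auto simp: filled_def mem_strip_slab[of i])
      show "(x, y) \<in> {real_of_int i<..<of_int (i + 1)} \<times> {real_of_int (h' i)<..<of_int (h i)}"
        using slab gap(2,3) by simp
    qed
  qed
qed

lemma curve_Un_inside: "curve \<union> inside curve = filled"
proof (rule Un_inside_eq_vertically_convex)
  show "compact filled" unfolding filled_def by (rule compact_strip[OF filled_bounds])
  show "(x, y') \<in> filled"
    if "(x, y) \<in> filled" "(x, y'') \<in> filled" "y \<le> y'" "y' \<le> y''" for x y y' y''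
    using that by (auto simp: filled_def strip_def split: if_splits)
qed (rule curve_subset_filled filled_minus_curve_subset_interior)+

end

lemma weakly_above_strips:
  assumes "weakly_above ps qs" "path_trace ps = strip s m lo hi h h"
    and "path_trace qs = strip s m lo' hi' h' h'" and "i \<in> {s..<m}"
  shows "h' i \<le> h i"
proof -
  have slab: "real_of_int i < i + 1/2" "real_of_int i + 1/2 < of_int (i + 1)" by simp_all
  have "(real_of_int i + 1/2, real_of_int (h i)) \<in> path_trace ps"
    "(real_of_int i + 1/2, real_of_int (h' i)) \<in> path_trace qs"
    unfolding assms(2,3) using assms(4) by (simp_all add: mem_strip_slab[OF slab])
  then have "real_of_int (h' i) \<le> h i"
    using assms(1) not_Ints_between(1)[OF slab] unfolding weakly_above_def by blast
  then show ?thesis by simp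
qed

lemma enclosed_region_eq_column_region:
  assumes "0 < m"
    and upper: "x_monotone_path etap" "hd etap = (0, a1)" "last etap = (m, b1)"
    and lower: "x_monotone_path etam" "hd etam = (0, a0)" "last etam = (m, b0)"
    and "weakly_above etap etam"
  obtains l u where "\<And>i. i \<in> {0..m} \<Longrightarrow> l i \<le> u i"
    "enclosed_region (boundary_curve m a0 a1 b0 b1 etap etam) = column_region 0 m l u"
proof -
  obtain lo hi h where P: "strip_joins (0, a1) (m, b1) lo hi h"
    "path_trace etap = strip 0 m lo hi h h"
    using x_monotone_path_trace_eq_strip[OF upper(1)] upper by auto
  obtain lo' hi' h' where Q: "strip_joins (0, a0) (m, b0) lo' hi' h'"
    "path_trace etam = strip 0 m lo' hi' h' h'"
    using x_monotone_path_trace_eq_strip[OF lower(1)] lower by auto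
  interpret monotone_boundary m a0 a1 b0 b1 lo hi h lo' hi' h'
    by unfold_locales (use assms(1) P Q weakly_above_strips[OF assms(8)] in auto)
  have "boundary_curve m a0 a1 b0 b1 etap etam = curve"
    by (simp add: boundary_curve_def curve_def P(2) Q(2))
  then have "enclosed_region (boundary_curve m a0 a1 b0 b1 etap etam) =
      column_region 0 m (\<lambda>i. min (lo i) (lo' i)) (\<lambda>i. max (hi i) (hi' i))"
    by (auto simp: enclosed_region_def curve_Un_inside plane_pt_def mem_filled_column
        mem_column_region)
  then show ?thesis
    by (rule that[rotated]) (use filled_bounds in \<open>auto simp: strip_bounds_def\<close>)
qed

section \<open>Discounted exit potentials\<close>

lemma log_concavity_violation_separated:
  fixes x y z :: real
  assumes "0 \<le> x" "0 \<le> y" "0 \<le> z" "y\<^sup>2 < x * z"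
  obtains c where "0 \<le> c" "y < c * x" "c * y < z"
proof (cases "y = 0")
  case True
  have "0 < x * z" using assms(4) True by simp
  then have "0 < x" "0 < z" using assms by (auto simp: zero_less_mult_iff)
  then show ?thesis using that[of 1] True by simp
next
  case False
  have "0 < x * z" using assms(4) by (rule order_le_less_trans[OF zero_le_power2])
  then have pos: "0 < x" "0 < y" using assms False by (auto simp: zero_less_mult_iff)
  then have "y / x < z / y" using assms(4) by (simp add: field_simps power2_eq_square)
  then obtain c where c: "y / x < c" "c < z / y" using dense by blast
  have "0 < y / x" using pos by simp
  then have "0 \<le> c" using c(1) by linarith
  then show ?thesis using that[of c] c pos by (simp add: field_simps)
qed

locale lattice_walk =
  fixes K :: "int \<times> int \<Rightarrow> int \<times> int \<Rightarrow> real" and B :: "(int \<times> int) set"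
  assumes nonneg: "q \<in> neighbours p \<Longrightarrow> 0 \<le> K p q"
    and sum_le_1: "(\<Sum>q\<in>neighbours p. K p q) \<le> 1"
begin

definition avg :: "(int \<times> int \<Rightarrow> real) \<Rightarrow> int \<times> int \<Rightarrow> real" where
  "avg u p = (\<Sum>q\<in>neighbours p. K p q * u q)"

lemma avg_mono: "(\<And>q. q \<in> neighbours p \<Longrightarrow> u q \<le> v q) \<Longrightarrow> avg u p \<le> avg v p"
  unfolding avg_def by (intro sum_mono mult_left_mono nonneg)

lemma avg_le_const:
  assumes "\<And>q. q \<in> neighbours p \<Longrightarrow> u q \<le> c" "0 \<le> c"
  shows "avg u p \<le> c"
proof -
  have "avg u p \<le> avg (\<lambda>_. c) p" using assms(1) by (rule avg_mono)
  also have "\<dots> = (\<Sum>q\<in>neighbours p. K p q) * c" by (simp add: avg_def sum_distrib_right)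
  also have "\<dots> \<le> c" using mult_right_mono[OF sum_le_1 assms(2)] by simp
  finally show ?thesis .
qed

lemma avg_nonneg: "(\<And>q. q \<in> neighbours p \<Longrightarrow> 0 \<le> u q) \<Longrightarrow> 0 \<le> avg u p"
  unfolding avg_def by (intro sum_nonneg mult_nonneg_nonneg nonneg)

lemma avg_linear: "avg (\<lambda>p. c * u p + d * v p) p = c * avg u p + d * avg v p"
  by (simp add: avg_def sum.distrib sum_distrib_left algebra_simps)

text \<open>The probability that the walk from \<open>p\<close>, killed outside \<open>G\<close>, is at \<open>a\<close> at time \<open>n\<close> and has not
  visited \<open>B\<close> before; for \<open>a\<close> in \<open>B\<close> this is its first visit to \<open>B\<close>.\<close>

primrec hit :: "(int \<times> int) set \<Rightarrow> int \<times> int \<Rightarrow> nat \<Rightarrow> int \<times> int \<Rightarrow> real" where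
  "hit G a 0 = (\<lambda>p. if p = a \<and> p \<in> G then 1 else 0)"
| "hit G a (Suc n) = (\<lambda>p. if p \<in> G - B then avg (hit G a n) p else 0)"

definition potential :: "real \<Rightarrow> (int \<times> int) set \<Rightarrow> int \<times> int \<Rightarrow> int \<times> int \<Rightarrow> real" where
  "potential z G a p = (\<Sum>n. hit G a n p * z ^ n)"

definition discounted_harmonic :: "real \<Rightarrow> (int \<times> int) set \<Rightarrow> (int \<times> int \<Rightarrow> real) \<Rightarrow> bool" where
  "discounted_harmonic z G u \<longleftrightarrow>
     (\<forall>p\<in>-G. u p = 0) \<and> (\<forall>p\<in>G - B. u p = z * avg u p)"

lemma discounted_harmonic_outside: "discounted_harmonic z G u \<Longrightarrow> p \<notin> G \<Longrightarrow> u p = 0"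
  by (simp add: discounted_harmonic_def)

lemma discounted_harmonic_inside:
  "discounted_harmonic z G u \<Longrightarrow> p \<in> G \<Longrightarrow> p \<notin> B \<Longrightarrow> u p = z * avg u p"
  by (simp add: discounted_harmonic_def)

lemma discounted_harmonic_linear:
  assumes "discounted_harmonic z G u" "discounted_harmonic z G v"
  shows "discounted_harmonic z G (\<lambda>p. c * u p + d * v p)"
  using assms unfolding discounted_harmonic_def avg_linear by (auto simp: algebra_simps)

lemma hit_outside: "p \<notin> G \<Longrightarrow> hit G a n p = 0"
  by (cases n) auto

lemma hit_nonneg: "0 \<le> hit G a n p"
  by (induction n arbitrary: p) (auto intro: avg_nonneg)

lemma hit_le_1: "hit G a n p \<le> 1"
  by (induction n arbitrary: p) (auto intro: avg_le_const)

lemma hit_translate: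
  assumes "\<And>p q. K (p + v) (q + v) = K p q" "\<And>p. p + v \<in> B \<longleftrightarrow> p \<in> B"
  shows "hit ((\<lambda>p. p + v) ` G) (a + v) n (p + v) = hit G a n p"
proof (induction n arbitrary: p)
  case 0
  show ?case by auto
next
  case (Suc n)
  have "neighbours (p + v) = (\<lambda>q. q + v) ` neighbours p"
    by (cases v) (auto simp: neighbours_def algebra_simps)
  then have "avg (hit ((\<lambda>p. p + v) ` G) (a + v) n) (p + v) = avg (hit G a n) p"
    by (simp add: avg_def sum.reindex assms(1) Suc)
  then show ?case using assms(2) by auto
qed

lemma summable_hit:
  assumes "0 \<le> z" "z < 1"
  shows "summable (\<lambda>n. hit G a n p * z ^ n)"
proof (rule summable_comparison_test')
  show "summable (\<lambda>n. z ^ n)" using assms by (simp add: summable_geometric)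
  show "norm (hit G a n p * z ^ n) \<le> z ^ n" for n
    using hit_nonneg hit_le_1 assms by (simp add: abs_mult mult_left_le_one_le)
qed

lemma potential_nonneg: "0 \<le> z \<Longrightarrow> z < 1 \<Longrightarrow> 0 \<le> potential z G a p"
  unfolding potential_def by (intro suminf_nonneg summable_hit) (auto simp: hit_nonneg)

lemma potential_translate:
  assumes "\<And>p q. K (p + v) (q + v) = K p q" "\<And>p. p + v \<in> B \<longleftrightarrow> p \<in> B"
  shows "potential z ((\<lambda>p. p + v) ` G) (a + v) (p + v) = potential z G a p"
  using hit_translate[OF assms] by (simp add: potential_def)

lemma potential_exit:
  assumes "p \<in> B"
  shows "potential z G a p = (if p = a \<and> a \<in> G then 1 else 0)"
proof -
  have "hit G a n p = 0" if "n \<notin> {0}" for n using that assms by (cases n) auto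
  then have "potential z G a p = (\<Sum>n\<in>{0}. hit G a n p * z ^ n)"
    unfolding potential_def by (intro suminf_finite) auto
  then show ?thesis by auto
qed

lemma potential_harmonic:
  assumes "0 \<le> z" "z < 1" "a \<in> B"
  shows "discounted_harmonic z G (potential z G a)"
proof -
  have "potential z G a p = z * avg (potential z G a) p" if p: "p \<in> G" "p \<notin> B" for p
  proof -
    have sums: "(\<lambda>n. hit G a n q * z ^ n) sums potential z G a q" for q
      unfolding potential_def using summable_hit[OF assms(1,2)] by (rule summable_sums)
    have "(\<lambda>n. z * (\<Sum>q\<in>neighbours p. K p q * (hit G a n q * z ^ n))) sums
        (z * avg (potential z G a) p)"
      unfolding avg_def by (intro sums_mult sums_sum sums)
    also have "(\<lambda>n. z * (\<Sum>q\<in>neighbours p. K p q * (hit G a n q * z ^ n))) =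
        (\<lambda>n. hit G a (Suc n) p * z ^ Suc n)"
      using p by (simp add: avg_def sum_distrib_left sum_distrib_right mult_ac)
    finally have "(\<lambda>n. hit G a n p * z ^ n) sums
        (z * avg (potential z G a) p + hit G a 0 p * z ^ 0)"
      by (rule sums_Suc)
    moreover have "hit G a 0 p = 0" using p assms(3) by auto
    ultimately show ?thesis using sums[of p] sums_unique2 by fastforce
  qed
  then show ?thesis
    by (auto simp: discounted_harmonic_def potential_def hit_outside)
qed

lemma potential_tendsto_sum:
  assumes "(\<lambda>n. hit G a n p) sums e"
  shows "((\<lambda>z. potential z G a p) \<longlongrightarrow> e) (at_left 1)"
proof -
  have "((\<lambda>z. hit G a n p * z ^ n) \<longlongrightarrow> hit G a n p * 1 ^ n) (at_left 1)" for n
    by (intro tendsto_intros)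
  moreover have "norm (hit G a n p * z ^ n) \<le> hit G a n p" if "z \<in> {0<..<1}" for n and z :: real
    using that hit_nonneg[of G a n p] power_le_one[of z n] by (simp add: abs_mult mult_left_le)
  then have "\<forall>\<^sub>F (n, z) in at_top \<times>\<^sub>F at_left 1. norm (hit G a n p * z ^ n) \<le> hit G a n p"
    by (intro eventually_mono[OF iffD2[OF eventually_prod2 eventually_at_left_real[of 0 1]]]) auto
  ultimately have "((\<lambda>z. \<Sum>n. hit G a n p * z ^ n) \<longlongrightarrow> (\<Sum>n. hit G a n p * 1 ^ n)) (at_left 1)"
    using sums_summable[OF assms] by (intro tannerys_theorem[THEN conjunct2, THEN conjunct2]) auto
  then show ?thesis using sums_unique[OF assms] by (simp add: potential_def)
qed

lemma maximum_principle:
  assumes "finite S" "0 \<le> z" "z < 1"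
    and subharmonic: "\<And>p. p \<in> S \<Longrightarrow> v p \<le> 0 \<or> v p \<le> z * avg v p"
    and outside: "\<And>p. p \<notin> S \<Longrightarrow> v p \<le> 0"
  shows "v p \<le> 0"
proof (rule ccontr)
  assume "\<not> v p \<le> 0"
  then have "p \<in> S" using outside by blast
  define c where "c = Max (v ` S)"
  have "c \<in> v ` S" unfolding c_def using assms(1) \<open>p \<in> S\<close> by (intro Max_in) auto
  then obtain q where q: "q \<in> S" "v q = c" by auto
  have max_S: "v r \<le> c" if "r \<in> S" for r using that assms(1) by (simp add: c_def)
  then have "0 < c" using \<open>p \<in> S\<close> \<open>\<not> v p \<le> 0\<close> by fastforce
  then have "v r \<le> c" for r using max_S outside[of r] by (cases "r \<in> S") auto
  then have "z * avg v q \<le> z * c"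
    using \<open>0 < c\<close> \<open>0 \<le> z\<close> by (intro mult_left_mono avg_le_const) auto
  also have "\<dots> < c" using \<open>z < 1\<close> \<open>0 < c\<close> by simp
  finally show False using subharmonic[OF q(1)] q(2) \<open>0 < c\<close> by simp
qed

lemma positive_set_linked_to_exit:
  assumes "finite G" "0 \<le> z" "z < 1" and harmonic: "discounted_harmonic z G u"
    and exit: "\<And>p. p \<in> G \<inter> B \<Longrightarrow> p \<noteq> a \<Longrightarrow> u p \<le> 0"
    and "u t > 0"
  shows "linked {p \<in> G. u p > 0} t a"
proof (rule ccontr)
  define S where "S = {p. linked {p \<in> G. u p > 0} t p}"
  define v where "v p = (if p \<in> S then u p else 0)" for p
  assume "\<not> linked {p \<in> G. u p > 0} t a"
  then have "a \<notin> S" by (simp add: S_def)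
  have S: "p \<in> G" "u p > 0" if "p \<in> S" for p
    using that linked_imp_mem(2)[of "{p \<in> G. u p > 0}" t p] by (simp_all add: S_def)
  have "t \<in> G" using discounted_harmonic_outside[OF harmonic, of t] \<open>u t > 0\<close> by force
  then have "t \<in> S" using \<open>u t > 0\<close> by (simp add: S_def linked_refl)
  have "v t \<le> 0"
  proof (rule maximum_principle[where S = S and z = z])
    show "finite S" using S(1) finite_subset[OF _ assms(1)] by blast
    show "v p \<le> 0 \<or> v p \<le> z * avg v p" if "p \<in> S" for p
    proof -
      have "p \<notin> B" using exit[of p] S[OF that] that \<open>a \<notin> S\<close> by force
      then have "u p = z * avg u p" using discounted_harmonic_inside[OF harmonic] S that by blast
      moreover have "avg u p \<le> avg v p"
      proof (rule avg_mono)
        fix q assume "q \<in> neighbours p"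
        show "u q \<le> v q"
        proof (cases "u q > 0")
          case True
          then have "q \<in> G" using discounted_harmonic_outside[OF harmonic, of q] by force
          then have "linked {p \<in> G. u p > 0} p q"
            using True S[OF that] \<open>q \<in> neighbours p\<close> by (intro linked_edge) auto
          then have "q \<in> S" using that linked_trans unfolding S_def by blast
          then show ?thesis by (simp add: v_def)
        qed (auto simp: v_def dest: S)
      qed
      ultimately show ?thesis using that \<open>0 \<le> z\<close> by (simp add: v_def mult_left_mono)
    qed
  qed (use assms in \<open>auto simp: v_def\<close>)
  then show False using \<open>t \<in> S\<close> \<open>u t > 0\<close> by (simp add: v_def)
qed

lemma discounted_superharmonic:
  assumes v: "discounted_harmonic z W v" and "0 \<le> z" "p \<notin> B"
    and nonpos: "\<And>q. p \<notin> W \<Longrightarrow> q \<in> neighbours p \<inter> W \<Longrightarrow> v q \<le> 0"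
  shows "z * avg v p \<le> v p"
proof (cases "p \<in> W")
  case True
  then show ?thesis using discounted_harmonic_inside[OF v] \<open>p \<notin> B\<close> by simp
next
  case False
  have "v q \<le> 0" if "q \<in> neighbours p" for q
    using nonpos[OF False] that discounted_harmonic_outside[OF v, of q] by (cases "q \<in> W") auto
  then have "avg v p \<le> 0" by (intro avg_le_const) auto
  then show ?thesis
    using discounted_harmonic_outside[OF v False] \<open>0 \<le> z\<close> by (simp add: mult_nonneg_nonpos)
qed

lemma positive_in_subregion:
  assumes "finite G" "0 \<le> z" "z < 1" "W \<subseteq> G"
    and u: "discounted_harmonic z G u" and v: "discounted_harmonic z W v"
    and exit: "\<And>p. p \<in> G \<inter> B \<Longrightarrow> u p = v p"
    and "u x > 0"
  shows "\<exists>t\<in>W. v t > 0 \<and> (t = x \<or> neighbours t \<inter> (G - W) \<noteq> {})"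
proof (rule ccontr)
  assume none: "\<not> ?thesis"
  define w where "w p = 1 * u p + (-1) * v p" for p
  have "w x \<le> 0"
  proof (rule maximum_principle[where S = G and z = z])
    fix p assume p: "p \<in> G"
    show "w p \<le> 0 \<or> w p \<le> z * avg w p"
    proof (cases "p \<in> B")
      case True
      then show ?thesis using exit p by (simp add: w_def)
    next
      case False
      have "v q \<le> 0" if "p \<notin> W" "q \<in> neighbours p \<inter> W" for q
        using none p that neighbours_sym[of p q] by force
      then have "z * avg v p \<le> v p"
        by (rule discounted_superharmonic[OF v \<open>0 \<le> z\<close> False])
      then show ?thesis
        using discounted_harmonic_inside[OF u p False] unfolding w_def avg_linear
        by (simp add: algebra_simps)
    qed
  next
    fix p assume "p \<notin> G"
    then have "u p = 0" "v p = 0"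
      using discounted_harmonic_outside[OF u] discounted_harmonic_outside[OF v] \<open>W \<subseteq> G\<close> by blast+
    then show "w p \<le> 0" by (simp add: w_def)
  qed (use assms in auto)
  then have "v x > 0" using \<open>u x > 0\<close> by (simp add: w_def)
  then show False using none discounted_harmonic_outside[OF v, of x] by fastforce
qed

lemma positive_walk_to_exit:
  assumes "finite G" "0 \<le> z" "z < 1" "W \<subseteq> G"
    and u: "discounted_harmonic z G u" and v: "discounted_harmonic z W v"
    and "\<And>p. p \<in> G \<inter> B \<Longrightarrow> u p = v p" "\<And>p. p \<in> B \<Longrightarrow> p \<noteq> a \<Longrightarrow> v p \<le> 0"
    and "u x > 0"
  obtains t where "linked {p \<in> W. v p > 0} t a" "t = x \<or> neighbours t \<inter> (G - W) \<noteq> {}"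
proof -
  obtain t where t: "v t > 0" "t = x \<or> neighbours t \<inter> (G - W) \<noteq> {}"
    using positive_in_subregion[OF assms(1-4) u v assms(7,9)] by blast
  have "finite W" using assms(1,4) finite_subset by blast
  then have "linked {p \<in> W. v p > 0} t a"
    using assms(2,3) v assms(8) t(1) by (intro positive_set_linked_to_exit) auto
  then show ?thesis using t(2) that by blast
qed

lemma potential_log_concave:
  fixes m :: int and l u :: "int \<Rightarrow> int"
  defines "G \<equiv> column_region 0 m l u"
  assumes invariant: "\<And>p q. K (p + (0, 1)) (q + (0, 1)) = K p q" and B: "B = {m} \<times> UNIV"
    and z: "0 \<le> z" "z < 1" and lu: "\<And>i. i \<in> {0..m} \<Longrightarrow> l i \<le> u i"
    and origin: "(0, 0) \<in> G" and k: "(m, k - 1) \<in> G" "(m, k + 1) \<in> G"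
  shows "potential z G (m, k - 1) (0, 0) * potential z G (m, k + 1) (0, 0)
    \<le> (potential z G (m, k) (0, 0))\<^sup>2"
proof (rule ccontr)
  assume "\<not> ?thesis"
  then obtain c where "0 \<le> c"
    and above: "potential z G (m, k) (0, 0) < c * potential z G (m, k - 1) (0, 0)"
    and below: "c * potential z G (m, k) (0, 0) < potential z G (m, k + 1) (0, 0)"
    using log_concavity_violation_separated potential_nonneg[OF z] by (metis not_le)
  define G' where "G' = column_region 0 m (\<lambda>i. l i + 1) (\<lambda>i. u i + 1)"
  define W where "W = column_region 0 m (\<lambda>i. l i + 1) u"
  define f where "f c d A p = c * potential z A (m, k) p + d * potential z A (m, k + 1) p"
    for c d A p
  have subsets: "W \<subseteq> G" "W \<subseteq> G'" by (auto simp: W_def G_def G'_def mem_column_region)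
  have "(m, k) \<in> W" "(m, k + 1) \<in> W" using k by (auto simp: W_def G_def mem_column_region)
  then have exit: "f c d A p = (if p = (m, k) then c else if p = (m, k + 1) then d else 0)"
    if "A \<in> {G, G', W}" "p \<in> B" for c d A p
    using that subsets by (auto simp: f_def potential_exit)
  have harmonic: "discounted_harmonic z A (f c d A)" for c d A
    unfolding f_def by (intro discounted_harmonic_linear potential_harmonic z) (simp_all add: B)
  have "potential z G' (m, j + 1) (0, 1) = potential z G (m, j) (0, 0)" for j
    using potential_translate[OF invariant, of z G "(m, j)" "(0, 0)"]
    by (simp add: G_def G'_def translate_up_column_region B mem_Times_iff)
  from this[of "k - 1"] this[of k] have f_start: "f c (-1) G' (0, 1) > 0"
    using above by (simp add: f_def)
  obtain s where s: "linked {p \<in> W. f c (-1) W p > 0} s (m, k)"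
    "s = (0, 1) \<or> neighbours s \<inter> (G' - W) \<noteq> {}"
    by (rule positive_walk_to_exit[where a = "(m, k)",
          OF _ z subsets(2) harmonic harmonic _ _ f_start])
      (auto simp: exit G'_def finite_column_region)
  have f_start': "f (- c) 1 G (0, 0) > 0" using below by (simp add: f_def)
  obtain t where t: "linked {p \<in> W. f (- c) 1 W p > 0} t (m, k + 1)"
    "t = (0, 0) \<or> neighbours t \<inter> (G - W) \<noteq> {}"
    by (rule positive_walk_to_exit[where a = "(m, k + 1)",
          OF _ z subsets(1) harmonic harmonic _ _ f_start'])
      (auto simp: exit G_def finite_column_region \<open>0 \<le> c\<close>)
  have "0 \<le> m" using origin by (auto simp: G_def mem_column_region)
  have "\<exists>p\<in>neighbours s. fst p \<in> {0..m} \<and> u (fst p) < snd p" if "s \<noteq> (0, 1)"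
    using s(2) that by (fastforce simp: G'_def W_def mem_column_region)
  moreover have "\<exists>q\<in>neighbours t. fst q \<in> {0..m} \<and> snd q \<le> l (fst q)" if "t \<noteq> (0, 0)"
    using t(2) that by (fastforce simp: G_def W_def mem_column_region)
  ultimately have "{p \<in> W. f c (-1) W p > 0} \<inter> {p \<in> W. f (- c) 1 W p > 0} \<noteq> {}"
    using lu \<open>0 \<le> m\<close>
    by (intro rim_or_start_walks_meet[OF _ _ _ _ s(1) _ t(1)]) (auto simp: W_def)
  then show False by (auto simp: f_def)
qed

lemma hit_sum_log_concave:
  fixes m :: int and l u :: "int \<Rightarrow> int"
  defines "G \<equiv> column_region 0 m l u"
  assumes "\<And>p q. K (p + (0, 1)) (q + (0, 1)) = K p q" "B = {m} \<times> UNIV"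
    and "\<And>i. i \<in> {0..m} \<Longrightarrow> l i \<le> u i"
    and "(0, 0) \<in> G" and k: "(m, k - 1) \<in> G" "(m, k + 1) \<in> G"
    and e: "\<And>j. (m, j) \<in> G \<Longrightarrow> (\<lambda>n. hit G (m, j) n (0, 0)) sums e j"
  shows "e (k - 1) * e (k + 1) \<le> (e k)\<^sup>2"
proof -
  define P where "P j z = potential z G (m, j) (0, 0)" for j z
  have P: "(P j \<longlongrightarrow> e j) (at_left 1)" if "(m, j) \<in> G" for j
    unfolding P_def using potential_tendsto_sum[OF e[OF that]] .
  have "(m, k) \<in> G" using k by (auto simp: G_def mem_column_region)
  then have "((\<lambda>z. (P k z)\<^sup>2) \<longlongrightarrow> (e k)\<^sup>2) (at_left 1)"
    by (intro tendsto_power P)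
  moreover have "((\<lambda>z. P (k - 1) z * P (k + 1) z) \<longlongrightarrow> e (k - 1) * e (k + 1)) (at_left 1)"
    by (intro tendsto_mult P k)
  moreover have "P (k - 1) z * P (k + 1) z \<le> (P k z)\<^sup>2" if "z \<in> {0<..<1}" for z
    unfolding P_def G_def
    by (rule potential_log_concave) (use assms that in auto)
  then have "\<forall>\<^sub>F z in at_left 1. P (k - 1) z * P (k + 1) z \<le> (P k z)\<^sup>2"
    by (intro eventually_mono[OF eventually_at_left_real[of 0 1]]) auto
  ultimately show ?thesis by (intro tendsto_le) auto
qed

end

section \<open>First visits of a Markov chain\<close>

text \<open>A state with infinitely many successors contributes the junk value 0.\<close>

primrec first_visit :: "('s \<Rightarrow> 's \<Rightarrow> real) \<Rightarrow> 's set \<Rightarrow> 's \<Rightarrow> nat \<Rightarrow> 's \<Rightarrow> real" where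
  "first_visit K B a 0 = (\<lambda>s. if s = a then 1 else 0)"
| "first_visit K B a (Suc n) =
     (\<lambda>s. if s \<in> B then 0 else (\<Sum>s' | K s s' \<noteq> 0. K s s' * first_visit K B a n s'))"

locale finitely_branching_chain =
  fixes M :: "'w measure" and X :: "nat \<Rightarrow> 'w \<Rightarrow> 's :: countable" and s0 :: 's
    and K :: "'s \<Rightarrow> 's \<Rightarrow> real"
  assumes chain: "markov_chain M X s0 K"
    and finite_successors: "finite {s'. K s s' \<noteq> 0}"
begin

sublocale prob_space M
  using chain by (simp add: markov_chain_def)

lemma measurable_X [measurable]: "X t \<in> measurable M (count_space UNIV)"
  using chain by (simp add: markov_chain_def)

definition history :: "(nat \<Rightarrow> 's) \<Rightarrow> nat \<Rightarrow> 'w set" where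
  "history g j = {w \<in> space M. \<forall>t\<le>j. X t w = g t}"

definition first_visit_event :: "'s set \<Rightarrow> 's \<Rightarrow> nat \<Rightarrow> nat \<Rightarrow> 'w set" where
  "first_visit_event B a j n = {w \<in> space M. (\<forall>t<n. X (j + t) w \<notin> B) \<and> X (j + n) w = a}"

lemma history_in_events [measurable]: "history g j \<in> events"
  unfolding history_def by measurable

lemma first_visit_event_in_events [measurable]: "first_visit_event B a j n \<in> events"
  unfolding first_visit_event_def by measurable

lemma history_Suc: "history g (Suc j) = {w \<in> history g j. X (Suc j) w = g (Suc j)}"
  by (auto simp: history_def le_Suc_eq)

lemma first_visit_event_Suc:
  "first_visit_event B a j (Suc n) = {w \<in> first_visit_event B a (Suc j) n. X j w \<notin> B}"
  by (auto simp: first_visit_event_def All_less_Suc2)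

lemma prob_history_Suc: "prob (history g (Suc j)) = prob (history g j) * K (g j) (g (Suc j))"
proof (cases "prob (history g j) > 0")
  case True
  then have "\<P>(w in M. X (Suc j) w = g (Suc j) \<bar> \<forall>t\<le>j. X t w = g t) = K (g j) (g (Suc j))"
    using chain by (simp add: markov_chain_def history_def)
  moreover have "history g (Suc j) = {w \<in> space M. X (Suc j) w = g (Suc j) \<and> (\<forall>t\<le>j. X t w = g t)}"
    by (auto simp: history_def le_Suc_eq)
  ultimately show ?thesis
    using True by (simp add: cond_prob_def history_def field_simps)
next
  case False
  then have "prob (history g j) = 0" using measure_nonneg[of M "history g j"] by linarith
  moreover have "prob (history g (Suc j)) \<le> prob (history g j)"
    by (intro finite_measure_mono) (auto simp: history_Suc)
  ultimately show ?thesis using measure_nonneg[of M "history g (Suc j)"] by simp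
qed

lemma prob_split_next_state:
  assumes A: "A \<in> events" "A \<subseteq> history g j"
  shows "prob A = (\<Sum>s | K (g j) s \<noteq> 0. prob {w \<in> A. X (Suc j) w = s})"
proof -
  define A' where "A' s = {w \<in> A. X (Suc j) w = s}" for s
  have A'_event: "A' s \<in> events" for s
  proof -
    have "A' s = A \<inter> {w \<in> space M. X (Suc j) w = s}"
      using sets.sets_into_space[OF A(1)] by (auto simp: A'_def)
    then show ?thesis using A(1) by simp
  qed
  define R where "R = (\<Union>s\<in>{s. K (g j) s = 0}. A' s)"
  have "R \<in> null_sets M"
    unfolding R_def
  proof (rule null_sets_UN')
    fix s assume "s \<in> {s. K (g j) s = 0}"
    then have "prob (history (g(Suc j := s)) (Suc j)) = 0"
      by (subst prob_history_Suc) simp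
    moreover have "A' s \<subseteq> history (g(Suc j := s)) (Suc j)"
      using A(2) by (auto simp: A'_def history_def le_Suc_eq)
    ultimately show "A' s \<in> null_sets M"
      using A'_event[of s] finite_measure_mono[of "A' s" "history (g(Suc j := s)) (Suc j)"]
        measure_nonneg[of M "A' s"]
      by (simp add: null_sets_def emeasure_eq_measure)
  qed simp
  moreover have "A = (\<Union>s\<in>{s. K (g j) s \<noteq> 0}. A' s) \<union> R" by (auto simp: R_def A'_def)
  ultimately have "prob A = prob (\<Union>s\<in>{s. K (g j) s \<noteq> 0}. A' s)"
    using A'_event finite_successors by (simp add: measure_Un_null_set sets.finite_UN)
  also have "\<dots> = (\<Sum>s | K (g j) s \<noteq> 0. prob (A' s))"
    using A'_event finite_successors
    by (intro finite_measure_finite_Union) (auto simp: disjoint_family_on_def A'_def)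
  finally show ?thesis by (simp add: A'_def)
qed

lemma prob_first_visit_event:
  "prob (history g j \<inter> first_visit_event B a j n) = prob (history g j) * first_visit K B a n (g j)"
proof (induction n arbitrary: j g)
  case 0
  have "history g j \<inter> first_visit_event B a j 0 = (if g j = a then history g j else {})"
    by (auto simp: history_def first_visit_event_def)
  then show ?case by simp
next
  case (Suc n)
  let ?A = "history g j \<inter> first_visit_event B a j (Suc n)"
  show ?case
  proof (cases "g j \<in> B")
    case True
    then have "?A = {}" by (auto simp: history_def first_visit_event_Suc)
    then show ?thesis using True by simp
  next
    case False
    have "prob {w \<in> ?A. X (Suc j) w = s} =
        prob (history g j) * (K (g j) s * first_visit K B a n s)" for s
    proof -
      define g' where "g' = g(Suc j := s)"
      then have g': "g' j = g j" "g' (Suc j) = s" "history g' j = history g j"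
        by (auto simp: history_def)
      have "{w \<in> ?A. X (Suc j) w = s} = history g' (Suc j) \<inter> first_visit_event B a (Suc j) n"
        using False by (auto simp: history_def first_visit_event_Suc le_Suc_eq g'_def)
      then show ?thesis
        using Suc.IH[of g' "Suc j"] prob_history_Suc[of g' j] by (simp add: g')
    qed
    then have "prob ?A =
        (\<Sum>s | K (g j) s \<noteq> 0. prob (history g j) * (K (g j) s * first_visit K B a n s))"
      by (subst prob_split_next_state[of _ g j]) auto
    then show ?thesis using False by (simp add: sum_distrib_left)
  qed
qed

lemma prob_first_visit_event_start: "prob (first_visit_event B a 0 n) = first_visit K B a n s0"
proof -
  have start: "AE w in M. X 0 w = s0" using chain by (simp add: markov_chain_def)
  have "prob (first_visit_event B a 0 n) = prob (history (\<lambda>_. s0) 0 \<inter> first_visit_event B a 0 n)"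
    using start by (intro finite_measure_eq_AE) (auto simp: history_def first_visit_event_def)
  moreover have "prob (history (\<lambda>_. s0) 0) = 1"
    using start by (subst prob_eq_1) (auto simp: history_def)
  ultimately show ?thesis by (simp add: prob_first_visit_event)
qed

lemma first_visit_sums:
  assumes "a \<in> B"
  shows "(\<lambda>n. first_visit K B a n s0) sums
    \<P>(w in M. (\<exists>t. X t w \<in> B) \<and> X (LEAST t. X t w \<in> B) w = a)"
proof -
  have "disjoint_family (first_visit_event B a 0)"
    unfolding disjoint_family_on_def
  proof (intro ballI impI)
    fix n n' :: nat assume "n \<noteq> n'"
    then show "first_visit_event B a 0 n \<inter> first_visit_event B a 0 n' = {}"
      using assms by (cases n n' rule: linorder_cases) (auto simp: first_visit_event_def)
  qed
  then have "(\<lambda>n. prob (first_visit_event B a 0 n)) sums prob (\<Union>n. first_visit_event B a 0 n)"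
    by (intro finite_measure_UNION) auto
  moreover have "w \<in> first_visit_event B a 0 n \<longleftrightarrow> w \<in> space M \<and>
      (\<exists>t. X t w \<in> B) \<and> (LEAST t. X t w \<in> B) = n \<and> X n w = a" for w n
  proof
    assume "w \<in> first_visit_event B a 0 n"
    then have w: "w \<in> space M" "\<forall>t<n. X t w \<notin> B" "X n w = a" by (auto simp: first_visit_event_def)
    then have "(LEAST t. X t w \<in> B) = n"
      using assms by (intro Least_equality) (auto simp: not_less[symmetric])
    then show "w \<in> space M \<and> (\<exists>t. X t w \<in> B) \<and> (LEAST t. X t w \<in> B) = n \<and> X n w = a"
      using w assms by auto
  qed (auto simp: first_visit_event_def dest: not_less_Least)
  then have "(\<Union>n. first_visit_event B a 0 n) =
      {w \<in> space M. (\<exists>t. X t w \<in> B) \<and> X (LEAST t. X t w \<in> B) w = a}" by auto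
  ultimately show ?thesis by (simp add: prob_first_visit_event_start)
qed

end

lemma killed_kernel_support:
  assumes "\<And>p q. J p q \<noteq> 0 \<Longrightarrow> q \<in> neighbours p"
  shows "{s'. killed_kernel G J s s' \<noteq> 0} \<subseteq>
    (case s of None \<Rightarrow> {None} | Some p \<Rightarrow> insert None (Some ` neighbours p))"
proof
  fix s' assume "s' \<in> {s'. killed_kernel G J s s' \<noteq> 0}"
  then show "s' \<in> (case s of None \<Rightarrow> {None} | Some p \<Rightarrow> insert None (Some ` neighbours p))"
    using assms by (cases s; cases s') (auto split: if_splits)
qed

lemma finite_neighbours: "finite (neighbours p)"
  by (simp add: neighbours_def)

context lattice_walk
begin

lemma first_visit_killed_kernel:
  assumes agree: "\<And>p q. p \<in> G \<Longrightarrow> q \<in> neighbours p \<Longrightarrow> J p q = K p q"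
    and support: "\<And>p q. J p q \<noteq> 0 \<Longrightarrow> q \<in> neighbours p" and "p \<in> G"
  shows "first_visit (killed_kernel G J) (Some ` (G \<inter> B)) (Some a) n (Some p) = hit G a n p"
  using \<open>p \<in> G\<close>
proof (induction n arbitrary: p)
  case 0
  then show ?case by simp
next
  case (Suc n)
  define f where "f = first_visit (killed_kernel G J) (Some ` (G \<inter> B)) (Some a) n"
  have successors: "{s'. killed_kernel G J s s' \<noteq> 0} \<subseteq>
      (case s of None \<Rightarrow> {None} | Some p \<Rightarrow> insert None (Some ` neighbours p))" for s
    by (rule killed_kernel_support[OF support])
  have killed: "f None = 0"
    unfolding f_def
  proof (induction n)
    case (Suc n)
    then show ?case using successors[of None] by (auto intro!: sum.neutral)
  qed simp
  have "(\<Sum>s | killed_kernel G J (Some p) s \<noteq> 0. killed_kernel G J (Some p) s * f s) =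
      (\<Sum>s\<in>insert None (Some ` neighbours p). killed_kernel G J (Some p) s * f s)"
    using successors[of "Some p"]
    by (intro sum.mono_neutral_left) (auto simp: finite_neighbours)
  also have "\<dots> = (\<Sum>q\<in>neighbours p. killed_kernel G J (Some p) (Some q) * f (Some q))"
    by (subst sum.insert) (auto simp: finite_neighbours killed sum.reindex)
  also have "\<dots> = (\<Sum>q\<in>neighbours p. K p q * hit G a n q)"
    using Suc agree hit_outside by (intro sum.cong) (auto simp: f_def)
  finally show ?case
    using Suc.prems by (auto simp: f_def avg_def)
qed

lemma hit_sums_exit_prob:
  assumes chain: "markov_chain M X (Some p) (killed_kernel G J)"
    and agree: "\<And>p q. p \<in> G \<Longrightarrow> q \<in> neighbours p \<Longrightarrow> J p q = K p q"
    and support: "\<And>p q. J p q \<noteq> 0 \<Longrightarrow> q \<in> neighbours p"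
    and "p \<in> G" "a \<in> G \<inter> B"
  shows "(\<lambda>n. hit G a n p) sums exit_prob M X (G \<inter> B) a"
proof -
  interpret finitely_branching_chain M X "Some p" "killed_kernel G J"
  proof
    show "finite {s'. killed_kernel G J s s' \<noteq> 0}" for s
      by (rule finite_subset[OF killed_kernel_support[OF support]])
        (auto simp: finite_neighbours split: option.split)
  qed (rule chain)
  have "Some a \<in> Some ` (G \<inter> B)" using assms(5) by simp
  from first_visit_sums[OF this] show ?thesis
    by (simp add: first_visit_killed_kernel[OF agree support \<open>p \<in> G\<close>] exit_prob_def)
qed

end

section \<open>Log-concavity of the exit distribution\<close>

lemma sum_step_prob_neighbours:
  "(\<Sum>q\<in>neighbours p. step_prob r l u d p q) = r p + l p + u p + d p"
  by (simp add: neighbours_def step_prob_def)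

lemma step_prob_support: "step_prob r l u d p q \<noteq> 0 \<Longrightarrow> q \<in> neighbours p"
  by (auto simp: step_prob_def neighbours_def split: if_splits)

lemma exit_prob_log_concave:
  assumes G: "G = column_region 0 m l u" and B: "B = G \<inter> {m} \<times> UNIV"
    and lu: "\<And>i. i \<in> {0..m} \<Longrightarrow> l i \<le> u i" and origin: "(0, 0) \<in> G"
    and nonneg: "\<And>p. p \<in> G \<Longrightarrow> pip p \<ge> 0 \<and> pim p \<ge> 0 \<and> omp p \<ge> 0 \<and> omm p \<ge> 0"
    and sum_le_1: "\<And>p. p \<in> G \<Longrightarrow> pip p + pim p + omp p + omm p \<le> 1"
    and invariant: "\<And>i j j'. (i, j) \<in> G \<Longrightarrow> (i, j') \<in> G \<Longrightarrow>
      pip (i, j) = pip (i, j') \<and> pim (i, j) = pim (i, j') \<and>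
      omp (i, j) = omp (i, j') \<and> omm (i, j) = omm (i, j')"
    and chain: "markov_chain M X (Some (0, 0)) (killed_kernel G (step_prob pip pim omp omm))"
    and k: "(m, k - 1) \<in> G" "(m, k + 1) \<in> G"
  shows "exit_prob M X B (m, k - 1) * exit_prob M X B (m, k + 1) \<le> (exit_prob M X B (m, k))\<^sup>2"
proof -
  define base where "base p = (let i = max 0 (min m (fst p)) in (i, l i))" for p :: "int \<times> int"
  have "0 \<le> m" using origin by (auto simp: G mem_column_region)
  then have base: "base p \<in> G" for p
    using lu by (auto simp: base_def G mem_column_region Let_def)
  have base_eq: "pip p = pip (base p) \<and> pim p = pim (base p) \<and>
      omp p = omp (base p) \<and> omm p = omm (base p)" if "p \<in> G" for p
  proof -
    have "base p = (fst p, l (fst p))"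
      using that by (auto simp: base_def G mem_column_region Let_def)
    then show ?thesis using invariant[of "fst p" "snd p" "l (fst p)"] that base[of p] by simp
  qed
  define K where "K = step_prob (pip \<circ> base) (pim \<circ> base) (omp \<circ> base) (omm \<circ> base)"
  interpret lattice_walk K "{m} \<times> UNIV"
  proof
    show "0 \<le> K p q" for p q using nonneg[OF base[of p]] by (simp add: K_def step_prob_def)
    show "(\<Sum>q\<in>neighbours p. K p q) \<le> 1" for p
      using sum_le_1[OF base[of p]] by (simp add: K_def sum_step_prob_neighbours)
  qed
  have "(\<lambda>n. hit G (m, j) n (0, 0)) sums exit_prob M X B (m, j)" if "(m, j) \<in> G" for j
    unfolding B
  proof (rule hit_sums_exit_prob[OF chain _ step_prob_support])
    show "step_prob pip pim omp omm p q = K p q" if "p \<in> G" for p q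
      using base_eq[OF that] by (simp add: K_def step_prob_def)
  qed (use origin that in auto)
  moreover have "K (p + (0, 1)) (q + (0, 1)) = K p q" for p q
    by (auto simp: K_def step_prob_def base_def prod_eq_iff)
  ultimately show ?thesis
    using lu origin k unfolding G
    by (intro hit_sum_log_concave[where e = "\<lambda>j. exit_prob M X B (m, j)"]) simp_all
qed

theorem theorem4p1:
  fixes m a0 a1 b0 b1 :: int
    and etap etam :: "(int \<times> int) list"
    and C :: "(real \<times> real) set"
    and \<Gamma> \<alpha> \<beta> :: "(int \<times> int) set"
    and pip pim omp omm :: "int \<times> int \<Rightarrow> real"
    and M :: "'w measure"
    and X :: "nat \<Rightarrow> 'w \<Rightarrow> (int \<times> int) option"
  assumes "m > 0"
    and "a0 \<le> a1" and "\<alpha> = vertical_interval 0 a0 a1"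
    and "b0 \<le> b1" and "\<beta> = vertical_interval m b0 b1"
    and "x_monotone_path etap" and "hd etap = (0, a1)" and "last etap = (m, b1)"
    and "x_monotone_path etam" and "hd etam = (0, a0)" and "last etam = (m, b0)"
    and "weakly_above etap etam"
    and "C = boundary_curve m a0 a1 b0 b1 etap etam"
    and "\<Gamma> = enclosed_region C"
    and "simply_connected (C \<union> inside C)"
    and "{p \<in> \<Gamma>. fst p = m} = \<beta>"
    and "(0, 0) \<in> \<alpha>"
    and "\<And>p. p \<in> \<Gamma> \<Longrightarrow> pip p \<ge> 0 \<and> pim p \<ge> 0 \<and> omp p \<ge> 0 \<and> omm p \<ge> 0"
    and "\<And>p. p \<in> \<Gamma> \<Longrightarrow> pip p + pim p + omp p + omm p = 1"
    and "\<And>i j j'. (i, j) \<in> \<Gamma> \<Longrightarrow> (i, j') \<in> \<Gamma> \<Longrightarrow>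
           pip (i, j) = pip (i, j') \<and> pim (i, j) = pim (i, j') \<and>
           omp (i, j) = omp (i, j') \<and> omm (i, j) = omm (i, j')"
    and "markov_chain M X (Some (0, 0)) (killed_kernel \<Gamma> (step_prob pip pim omp omm))"
  shows "\<forall>k. (m, k + 1) \<in> \<beta> \<and> (m, k - 1) \<in> \<beta> \<longrightarrow>
           (exit_prob M X \<beta> (m, k))\<^sup>2 \<ge> exit_prob M X \<beta> (m, k + 1) * exit_prob M X \<beta> (m, k - 1)"
proof (intro allI impI)
  fix k assume k: "(m, k + 1) \<in> \<beta> \<and> (m, k - 1) \<in> \<beta>"
  obtain l u where lu: "\<And>i. i \<in> {0..m} \<Longrightarrow> l i \<le> u i" and \<Gamma>: "\<Gamma> = column_region 0 m l u"
    using enclosed_region_eq_column_region[OF assms(1,6-12)] assms(13,14) by metis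
  have \<beta>: "\<beta> = \<Gamma> \<inter> {m} \<times> UNIV" using assms(16) by auto
  have "plane_pt (0, 0) \<in> closed_segment (plane_pt (0, a0)) (plane_pt (0, a1))"
    using assms(3,17) unfolding closed_segment_plane_pt_vertical
    by (auto simp: vertical_interval_def plane_pt_def)
  then have origin: "(0, 0) \<in> \<Gamma>" by (simp add: assms(13,14) enclosed_region_def boundary_curve_def)
  have "exit_prob M X \<beta> (m, k - 1) * exit_prob M X \<beta> (m, k + 1) \<le> (exit_prob M X \<beta> (m, k))\<^sup>2"
  proof (rule exit_prob_log_concave[OF \<Gamma> \<beta>])
    show "(m, k - 1) \<in> \<Gamma>" "(m, k + 1) \<in> \<Gamma>" using k by (auto simp: \<beta>)
    show "pip p + pim p + omp p + omm p \<le> 1" if "p \<in> \<Gamma>" for p using assms(19)[OF that] by simp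
  qed (fact lu origin assms(18,20,21))+
  then show "(exit_prob M X \<beta> (m, k))\<^sup>2 \<ge> exit_prob M X \<beta> (m, k + 1) * exit_prob M X \<beta> (m, k - 1)"
    by (simp add: mult.commute)
qed

end
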